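(* Let $\mu_0,\nu_0\in\mathcal P_2^*(\mathbb R^2)$ be template measures with $\mathcal N_{\mathrm a}[\mu_0]\neq\mathcal N_{\mathrm a}[\nu_0]$, and define $$c_\mu:=\min_{\boldsymbol\theta\in\mathbb S_1}\operatorname{std}(\widehat{\mathcal R}_{\boldsymbol\theta}[\mu_0]),\quad C_\mu:=\lVert\mathcal N[\mu_0]\rVert_{\rho\times u_{\mathbb S_1}},\quad c_\nu:=\min_{\boldsymbol\theta\in\mathbb S_1}\operatorname{std}(\widehat{\mathcal R}_{\boldsymbol\theta}[\nu_0]),\quad C_\nu:=\lVert\mathcal N[\nu_0]\rVert_{\rho\times u_{\mathbb S_1}}.$$ Let $c\in(0,\tfrac12)$, $c'\in(c,\tfrac12)$, and let $0\le\epsilon<\min\{c_\mu,c_\nu\}/2$ satisfy $$\epsilon<\frac{c'-c}{4}\,\min\{c_\mu,c_\nu\}\,\frac{\lVert\mathcal N_{\mathrm a}[\mu_0]-\mathcal N_{\mathrm a}[\nu_0]\rVert_\rho\,\max\{C_\mu,C_\nu\}}{c\,\lVert\mathcal N_{\mathrm a}[\mu_0]-\mathcal N_{\mathrm a}[\nu_0]\rVert_\rho+\max\{C_\mu,C_\nu\}}.$$ Let $$\mathcal X=\left\{\mathbf A\in\mathrm{GL}(2)\ \middle|\ \frac{\sigma_{\max}(\mathbf A)-\sigma_{\min}(\mathbf A)}{\sigma_{\min}(\mathbf A)}\le\frac{c}{\max\{C_\mu,C_\nu\}}\,\lVert\mathcal N_{\mathrm a}[\mu_0]-\mathcal N_{\mathrm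 a}[\nu_0]\rVert_\rho\right\}$$ and consider the classes $$\mathbb F:=\{(\mathbf A\cdot+\mathbf y)_\#\mu\mid\mathbf A\in\mathcal X,\ \mathbf y\in\mathbb R^2,\ \mu\in\mathcal P_2(\mathbb R^2),\ W_2(\mu,\mu_0)\le\epsilon\},$$ $$\mathbb G:=\{(\mathbf A\cdot+\mathbf y)_\#\nu\mid\mathbf A\in\mathcal X,\ \mathbf y\in\mathbb R^2,\ \nu\in\mathcal P_2(\mathbb R^2),\ W_2(\nu,\nu_0)\le\epsilon\}.$$ Then any non-empty subsets $\mathbb F_0\subseteq\mathbb F$ and $\mathbb G_0\subseteq\mathbb G$ are linearly separable in mean-normalized R-CDT space, i.e. there exist a continuous linear functional $\Phi\colon L^2_\rho(\mathbb R)\to\mathbb R$ and a constant $b\in\mathbb R$ such that $$\Phi(\mathcal N_{\mathrm a}[\mu])<b<\Phi(\mathcal N_{\mathrm a}[\nu])\qquad\text{for all }\mu\in\mathbb F_0,\ \nu\in\mathbb G_0.$$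
   Context: $\mathcal P(X)$ denotes the Borel probability measures on $X$, and $T_\#\mu=\mu\circ T^{-1}$ the push-forward. $\mathbb S_1=\{\boldsymbol\theta\in\mathbb R^2: \lVert\boldsymbol\theta\rVert=1\}$ and $u_{\mathbb S_1}=\sigma_{\mathbb S_1}/(2\pi)$ is the uniform probability measure on it ($\sigma_{\mathbb S_1}$ the arc-length measure). For $\mu\in\mathcal P(\mathbb R^2)$, $\dim(\mu)$ is the dimension of the affine hull of $\operatorname{supp}(\mu)$. $\mathcal P_2(\mathbb R^2)$ denotes the probability measures with finite second moment, and $\mathcal P_2^*(\mathbb R^2)=\{\mu\in\mathcal P_2(\mathbb R^2):\dim(\mu)>1\}$. $W_2$ is the Wasserstein-2 distance $W_2(\mu,\nu)=\inf_{\pi\in\Pi(\mu,\nu)}\bigl(\int\lVert\mathbf x-\mathbf y\rVert^2\,\mathrm d\pi(\mathbf x,\mathbf y)\bigr)^{1/2}$, $\Pi(\mu,\nu)$ being the set of couplings. $\sigma_{\max}(\mathbf A)$, $\sigma_{\min}(\mathbf A)$ are the largest and smallest singular values of $\mathbf A$. Restricted Radon transform: $\mathcal R_{\boldsymbol\theta}[\mu]=(S_{\boldsymbol\theta})_\#\mu\in\mathcal P(\mathbb R)$ with $S_{\boldsymbol\theta}(\mathbf x)=\langle\mathbf x,\boldsymbol\theta\rangle$. Throughout, $\rho$ is a fixed reference measure: a Borel probability measure on $\mathbb R$ with finite second moment and without atoms. For $\nu\in\mathcal P(\mathbb R)$, $F_\nu(t)=\nu((-\infty,t])$, $F_\nu^{[-1]}(t)=\inf\{s\in\mathbb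 R: F_\nu(s)>t\}$, and $\widehat\nu=F_\nu^{[-1]}\circ F_\rho$ (finite $\rho$-a.e.). For $\mu\in\mathcal P(\mathbb R^2)$, the R-CDT is $\widehat{\mathcal R}_{\boldsymbol\theta}[\mu]=\widehat{\mathcal R}[\mu](\cdot,\boldsymbol\theta)=\widehat{\nu}$ with $\nu=\mathcal R_{\boldsymbol\theta}[\mu]$. For $g\in L^2_\rho(\mathbb R)$: $\operatorname{mean}(g)=\int_{\mathbb R} g\,\mathrm d\rho$, $\operatorname{std}(g)=\bigl(\int_{\mathbb R}\lvert g-\operatorname{mean}(g)\rvert^2\,\mathrm d\rho\bigr)^{1/2}$. The normalized R-CDT is $$\mathcal N[\mu](t,\boldsymbol\theta)=\frac{\widehat{\mathcal R}_{\boldsymbol\theta}[\mu](t)-\operatorname{mean}(\widehat{\mathcal R}_{\boldsymbol\theta}[\mu])}{\operatorname{std}(\widehat{\mathcal R}_{\boldsymbol\theta}[\mu])},$$ and the mean-normalized R-CDT is $\mathcal N_{\mathrm a}[\mu](t)=\int_{\mathbb S_1}\mathcal N[\mu](t,\boldsymbol\theta)\,\mathrm du_{\mathbb S_1}(\boldsymbol\theta)$. For $\mu\in\mathcal P_2^*(\mathbb R^2)$ these are well defined with $\mathcal N[\mu]\in L^2_{\rho\times u_{\mathbb S_1}}(\mathbb R\times\mathbb S_1)$ and $\mathcal N_{\mathrm a}[\mu]\in L^2_\rho(\mathbb R)$. $\lVert\cdot\rVert_\rho$ and $\lVert\cdot\rVert_{\rho\times u_{\mathbb S_1}}$ are the norms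 of these $L^2$ spaces. *)

theory Defs
  imports "HOL-Probability.Probability"
begin

section \<open>Measures on the plane\<close>

definition borel_prob :: "'a::topological_space measure \<Rightarrow> bool" where
  "borel_prob \<mu> \<longleftrightarrow> prob_space \<mu> \<and> sets \<mu> = sets borel"

definition measure_support :: "'a::topological_space measure \<Rightarrow> 'a set" where
  "measure_support \<mu> = {x. \<forall>U. open U \<and> x \<in> U \<longrightarrow> emeasure \<mu> U > 0}"

definition measure_dim :: "(real^2) measure \<Rightarrow> int" where
  "measure_dim \<mu> = aff_dim (affine hull (measure_support \<mu>))"

definition P2 :: "'a::real_normed_vector measure set" where
  "P2 = {\<mu>. borel_prob \<mu> \<and> integrable \<mu> (\<lambda>x. (norm x)\<^sup>2)}"

definition P2_star :: "(real^2) measure set" where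
  "P2_star = {\<mu> \<in> P2. measure_dim \<mu> > 1}"

definition couplings ::
    "(real^2) measure \<Rightarrow> (real^2) measure \<Rightarrow> ((real^2) \<times> (real^2)) measure set" where
  "couplings \<mu> \<nu> = {\<pi>. borel_prob \<pi> \<and> distr \<pi> borel fst = \<mu> \<and> distr \<pi> borel snd = \<nu>}"

text \<open>Intended for \<open>\<mu>, \<nu> \<in> P2\<close> only: then every cost integral is finite and the infimum is
  over a nonempty set of nonnegative reals.\<close>

definition W2 :: "(real^2) measure \<Rightarrow> (real^2) measure \<Rightarrow> real" where
  "W2 \<mu> \<nu> = (INF \<pi> \<in> couplings \<mu> \<nu>. sqrt (\<integral>p. (norm (fst p - snd p))\<^sup>2 \<partial>\<pi>))"

section \<open>The unit circle\<close>

abbreviation S1 :: "(real^2) set" where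
  "S1 \<equiv> sphere 0 1"

text \<open>Arc length is the push-forward of Lebesgue measure under the unit-speed
  parametrisation of the circle.\<close>

definition arclength_S1 :: "(real^2) measure" where
  "arclength_S1 = distr (restrict_space lborel {0..<2 * pi}) (restrict_space borel S1)
                    (\<lambda>\<phi>. vector [cos \<phi>, sin \<phi>])"

definition unif_S1 :: "(real^2) measure" where
  "unif_S1 = scale_measure (ennreal (1 / (2 * pi))) arclength_S1"

section \<open>Singular values\<close>

text \<open>Square roots of the eigenvalues of the Gram matrix.\<close>

definition singular_values :: "real^2^2 \<Rightarrow> real set" where
  "singular_values A =
     {s. 0 \<le> s \<and> (\<exists>v. v \<noteq> 0 \<and> (transpose A ** A) *v v = s\<^sup>2 *\<^sub>R v)}"

definition sigma_max :: "real^2^2 \<Rightarrow> real" where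
  "sigma_max A = Max (singular_values A)"

definition sigma_min :: "real^2^2 \<Rightarrow> real" where
  "sigma_min A = Min (singular_values A)"

section \<open>\<open>L\<^sup>2\<close> spaces\<close>

text \<open>Elements of \<open>L\<^sup>2\<close> are represented by square-integrable functions; equality in \<open>L\<^sup>2\<close> is
  equality almost everywhere.\<close>

definition L2 :: "'a measure \<Rightarrow> ('a \<Rightarrow> real) set" where
  "L2 M = {g \<in> borel_measurable M. integrable M (\<lambda>x. (g x)\<^sup>2)}"

definition L2_norm :: "'a measure \<Rightarrow> ('a \<Rightarrow> real) \<Rightarrow> real" where
  "L2_norm M g = sqrt (\<integral>x. (g x)\<^sup>2 \<partial>M)"

text \<open>The continuity clause forces a.e. equal functions (which are at \<open>L\<^sup>2\<close> distance 0) to have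
  the same value, so such a functional descends to the space of a.e. classes.\<close>

definition continuous_linear_functional_L2 :: "'a measure \<Rightarrow> (('a \<Rightarrow> real) \<Rightarrow> real) \<Rightarrow> bool" where
  "continuous_linear_functional_L2 M \<Phi> \<longleftrightarrow>
     (\<forall>g\<in>L2 M. \<forall>h\<in>L2 M. \<Phi> (\<lambda>x. g x + h x) = \<Phi> g + \<Phi> h) \<and>
     (\<forall>a. \<forall>g\<in>L2 M. \<Phi> (\<lambda>x. a * g x) = a * \<Phi> g) \<and>
     (\<forall>g\<in>L2 M. \<forall>e>0. \<exists>d>0. \<forall>h\<in>L2 M. L2_norm M (\<lambda>x. h x - g x) < d \<longrightarrow> \<bar>\<Phi> h - \<Phi> g\<bar> < e)"

definition mean :: "real measure \<Rightarrow> (real \<Rightarrow> real) \<Rightarrow> real" where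
  "mean \<rho> g = (\<integral>t. g t \<partial>\<rho>)"

definition std :: "real measure \<Rightarrow> (real \<Rightarrow> real) \<Rightarrow> real" where
  "std \<rho> g = sqrt (\<integral>t. \<bar>g t - mean \<rho> g\<bar>\<^sup>2 \<partial>\<rho>)"

section \<open>Radon transform and (normalized) R-CDT\<close>

definition radon :: "(real^2) measure \<Rightarrow> real^2 \<Rightarrow> real measure" where
  "radon \<mu> \<theta> = distr \<mu> borel (\<lambda>x. x \<bullet> \<theta>)"

text \<open>Extended-real valued, as the set is empty for \<open>t \<ge> 1\<close> and may be unbounded below for
  \<open>t \<le> 0\<close>.\<close>

definition quantile :: "real measure \<Rightarrow> real \<Rightarrow> ereal" where
  "quantile \<nu> t = (INF s \<in> {s. cdf \<nu> s > t}. ereal s)"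

text \<open>For atomless \<open>\<rho>\<close> the quantile is finite at \<open>\<rho>\<close>-almost every \<open>t\<close>; the remaining infinite
  values are sent to 0 by \<open>real_of_ereal\<close>.\<close>

definition cdt :: "real measure \<Rightarrow> real measure \<Rightarrow> real \<Rightarrow> real" where
  "cdt \<rho> \<nu> t = real_of_ereal (quantile \<nu> (cdf \<rho> t))"

definition rcdt :: "real measure \<Rightarrow> (real^2) measure \<Rightarrow> real^2 \<Rightarrow> real \<Rightarrow> real" where
  "rcdt \<rho> \<mu> \<theta> = cdt \<rho> (radon \<mu> \<theta>)"

definition nrcdt :: "real measure \<Rightarrow> (real^2) measure \<Rightarrow> real \<times> (real^2) \<Rightarrow> real" where
  "nrcdt \<rho> \<mu> = (\<lambda>(t, \<theta>). (rcdt \<rho> \<mu> \<theta> t - mean \<rho> (rcdt \<rho> \<mu> \<theta>)) / std \<rho> (rcdt \<rho> \<mu> \<theta>))"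

definition mnrcdt :: "real measure \<Rightarrow> (real^2) measure \<Rightarrow> real \<Rightarrow> real" where
  "mnrcdt \<rho> \<mu> t = (\<integral>\<theta>. nrcdt \<rho> \<mu> (t, \<theta>) \<partial>unif_S1)"

text \<open>For \<open>\<mu> \<in> P2_star\<close> the infimum is a minimum: the function \<open>\<theta> \<mapsto> std (rcdt \<rho> \<mu> \<theta>)\<close> is
  continuous on the compact set \<open>S1\<close>.\<close>

definition min_std :: "real measure \<Rightarrow> (real^2) measure \<Rightarrow> real" where
  "min_std \<rho> \<mu> = (INF \<theta> \<in> S1. std \<rho> (rcdt \<rho> \<mu> \<theta>))"

definition perturbed_affine_class ::
    "(real^2^2) set \<Rightarrow> (real^2) measure \<Rightarrow> real \<Rightarrow> (real^2) measure set" where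
  "perturbed_affine_class \<X> \<mu>0 \<epsilon> =
     {distr \<mu> borel (\<lambda>x. A *v x + y) | A y \<mu>. A \<in> \<X> \<and> \<mu> \<in> P2 \<and> W2 \<mu> \<mu>0 \<le> \<epsilon>}"

end

theory Submission
  imports Defs
begin

text \<open>For every direction with positive standard deviation the function \<open>t \<mapsto> nrcdt \<rho> \<mu> (t, \<theta>)\<close> is the
  standardization of an \<open>L\<^sup>2\<close> function, so it has norm \<open>1\<close>, and both constants \<open>C_mu\<close> and \<open>C_nu\<close>
  equal \<open>1\<close>. With \<open>m > 0\<close> the smaller of \<open>c_mu\<close> and \<open>c_nu\<close>, the claim is that \<open>mnrcdt \<rho>\<close> maps both
  perturbed affine classes into balls of radius \<open>r = c * D + 2 * \<epsilon> / m < D / 2\<close> around the transforms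
  of the two templates, which have distance \<open>D\<close>. Pairing with the difference of the two centres
  separates such balls (\<open>L2_balls_linearly_separable\<close>). The radius has two contributions.

  \<^item> Perturbation. The quantile coupling is optimal on the line (\<open>monotone_coupling_optimal\<close>) and
  projecting to a line is a contraction, so \<open>W2 \<mu> \<mu>0 \<le> \<epsilon>\<close> bounds the \<open>L\<^sup>2\<close> distance of the two R-CDTs
  by \<open>\<epsilon>\<close> in every direction. Standardization turns this into \<open>2 * \<epsilon> / m\<close>, and averaging over the
  circle does not increase it (\<open>mnrcdt_perturbation\<close>).

  \<^item> Affine map. The law of \<open>A x + y\<close> projected to \<open>\<theta>\<close> is an increasing affine image of the law of \<open>x\<close>
  projected to \<open>h \<theta> = sgn (A\<^sup>T \<theta>)\<close>; standardization removes the affine image, so the new transform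
  is \<open>nrcdt \<rho> \<mu> (t, h \<theta>)\<close>. Substituting \<open>h\<close> in the circle average of \<open>nrcdt \<rho> \<mu> (t, \<theta>)\<close> produces the
  weight \<open>w \<theta> = \<bar>det A\<bar> / \<parallel>A\<^sup>T \<theta>\<parallel>\<^sup>2\<close> (\<open>integral_unif_S1_linear\<close>), which lies between
  \<open>\<sigma>_min / \<sigma>_max\<close> and \<open>\<sigma>_max / \<sigma>_min\<close>. Hence the two averages differ by that of
  \<open>(1 - w \<theta>) * nrcdt \<rho> \<mu> (t, h \<theta>)\<close>, of norm at most \<open>(\<sigma>_max - \<sigma>_min) / \<sigma>_min\<close>
  (\<open>mnrcdt_affine\<close>).\<close>


section \<open>Square-integrable functions\<close>

lemma L2_measurable: "f \<in> L2 M \<Longrightarrow> f \<in> borel_measurable M"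
  and L2_integrable_square: "f \<in> L2 M \<Longrightarrow> integrable M (\<lambda>x. (f x)\<^sup>2)"
  by (auto simp: L2_def)

lemma L2_norm_nonneg: "0 \<le> L2_norm M f"
  by (simp add: L2_norm_def)

lemma L2_norm_square: "(L2_norm M f)\<^sup>2 = (\<integral>x. (f x)\<^sup>2 \<partial>M)"
  by (simp add: L2_norm_def)

lemma L2_integrable_mult:
  assumes "f \<in> L2 M" "g \<in> L2 M"
  shows "integrable M (\<lambda>x. f x * g x)"
proof (rule Bochner_Integration.integrable_bound)
  show "integrable M (\<lambda>x. (f x)\<^sup>2 + (g x)\<^sup>2)"
    using assms by (simp add: L2_integrable_square)
  show "(\<lambda>x. f x * g x) \<in> borel_measurable M"
    using assms by (auto dest!: L2_measurable)
  have ab: "\<bar>a * b\<bar> \<le> \<bar>a\<^sup>2 + b\<^sup>2\<bar>" for a b :: real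
  proof -
    have "2 * \<bar>a * b\<bar> \<le> a\<^sup>2 + b\<^sup>2"
      using sum_squares_bound[of "\<bar>a\<bar>" "\<bar>b\<bar>"] by (simp add: abs_mult)
    then show ?thesis by linarith
  qed
  show "AE x in M. norm (f x * g x) \<le> norm ((f x)\<^sup>2 + (g x)\<^sup>2)"
    unfolding real_norm_def by (intro AE_I2 ab)
qed

lemma L2_cmult: "f \<in> L2 M \<Longrightarrow> (\<lambda>x. a * f x) \<in> L2 M"
  by (auto simp: L2_def power_mult_distrib)

lemma L2_add:
  assumes "f \<in> L2 M" "g \<in> L2 M"
  shows "(\<lambda>x. f x + g x) \<in> L2 M"
proof -
  have "integrable M (\<lambda>x. (f x)\<^sup>2 + (g x)\<^sup>2 + 2 * (f x * g x))"
    using assms L2_integrable_mult[OF assms] by (simp add: L2_integrable_square)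
  then show ?thesis
    using assms by (auto simp: L2_def power2_sum mult.assoc)
qed

lemma L2_diff:
  assumes "f \<in> L2 M" "g \<in> L2 M"
  shows "(\<lambda>x. f x - g x) \<in> L2 M"
  using L2_add[OF assms(1) L2_cmult[OF assms(2), of "-1"]] by simp

lemma L2_Cauchy_Schwarz:
  assumes f: "f \<in> L2 M" and g: "g \<in> L2 M"
  shows "\<bar>\<integral>x. f x * g x \<partial>M\<bar> \<le> L2_norm M f * L2_norm M g"
proof -
  define A B C where "A = (\<integral>x. (f x)\<^sup>2 \<partial>M)" and "B = (\<integral>x. f x * g x \<partial>M)"
    and "C = (\<integral>x. (g x)\<^sup>2 \<partial>M)"
  have q: "0 \<le> A - 2 * t * B + t\<^sup>2 * C" for t
  proof -
    have "0 \<le> (\<integral>x. (f x - t * g x)\<^sup>2 \<partial>M)" by simp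
    also have "(\<lambda>x. (f x - t * g x)\<^sup>2) = (\<lambda>x. (f x)\<^sup>2 - (2 * t) * (f x * g x) + t\<^sup>2 * (g x)\<^sup>2)"
      by (auto simp: power2_eq_square algebra_simps)
    also have "(\<integral>x. (f x)\<^sup>2 - (2 * t) * (f x * g x) + t\<^sup>2 * (g x)\<^sup>2 \<partial>M) = A - 2 * t * B + t\<^sup>2 * C"
      using L2_integrable_mult[OF f g] L2_integrable_square[OF f] L2_integrable_square[OF g]
      by (simp add: A_def B_def C_def)
    finally show ?thesis .
  qed
  have "0 \<le> C" by (simp add: C_def)
  have "B\<^sup>2 \<le> A * C"
  proof (cases "C = 0")
    case True
    have "B = 0"
    proof (rule ccontr)
      assume "B \<noteq> 0"
      then show False using q[of "(A + 1) / (2 * B)"] True by (simp add: field_simps)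
    qed
    then show ?thesis using True by simp
  next
    case False
    then have "0 < C" using \<open>0 \<le> C\<close> by simp
    have "A - 2 * (B / C) * B + (B / C)\<^sup>2 * C = A - B\<^sup>2 / C"
      using False by (simp add: power2_eq_square)
    then have "B\<^sup>2 / C \<le> A" using q[of "B / C"] by linarith
    then show ?thesis using \<open>0 < C\<close> by (simp add: pos_divide_le_eq)
  qed
  then have "sqrt (B\<^sup>2) \<le> sqrt (A * C)" by (rule real_sqrt_le_mono)
  then show ?thesis
    by (simp add: real_sqrt_mult L2_norm_def A_def B_def C_def)
qed

lemma L2_norm_cmult: "L2_norm M (\<lambda>x. a * f x) = \<bar>a\<bar> * L2_norm M f"
  by (simp add: L2_norm_def power_mult_distrib real_sqrt_mult)

lemma L2_norm_add_le:
  assumes f: "f \<in> L2 M" and g: "g \<in> L2 M"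
  shows "L2_norm M (\<lambda>x. f x + g x) \<le> L2_norm M f + L2_norm M g"
proof (rule power2_le_imp_le)
  have "(L2_norm M (\<lambda>x. f x + g x))\<^sup>2 = (\<integral>x. (f x)\<^sup>2 + 2 * (f x * g x) + (g x)\<^sup>2 \<partial>M)"
    unfolding L2_norm_square by (simp add: power2_sum algebra_simps)
  also have "\<dots> = (L2_norm M f)\<^sup>2 + 2 * (\<integral>x. f x * g x \<partial>M) + (L2_norm M g)\<^sup>2"
    using L2_integrable_mult[OF f g] L2_integrable_square[OF f] L2_integrable_square[OF g]
    by (simp add: L2_norm_square)
  also have "\<dots> \<le> (L2_norm M f + L2_norm M g)\<^sup>2"
    using L2_Cauchy_Schwarz[OF f g] by (simp add: power2_sum)
  finally show "(L2_norm M (\<lambda>x. f x + g x))\<^sup>2 \<le> (L2_norm M f + L2_norm M g)\<^sup>2" .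
qed (simp add: L2_norm_nonneg)

lemma L2_norm_minus_commute: "L2_norm M (\<lambda>x. f x - g x) = L2_norm M (\<lambda>x. g x - f x)"
  by (simp add: L2_norm_def power2_commute)

lemma L2_norm_cong_AE:
  assumes "f \<in> borel_measurable M" "g \<in> borel_measurable M" "AE x in M. f x = g x"
  shows "L2_norm M f = L2_norm M g"
proof -
  have "(\<integral>x. (f x)\<^sup>2 \<partial>M) = (\<integral>x. (g x)\<^sup>2 \<partial>M)"
    using assms by (intro integral_cong_AE) auto
  then show ?thesis by (simp add: L2_norm_def)
qed

lemma nn_integral_L2: "f \<in> L2 M \<Longrightarrow> (\<integral>\<^sup>+x. ennreal ((f x)\<^sup>2) \<partial>M) = ennreal ((L2_norm M f)\<^sup>2)"
  by (simp add: L2_norm_square nn_integral_eq_integral L2_integrable_square)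

lemma L2I_nn_integral:
  assumes [measurable]: "f \<in> borel_measurable M" and "0 \<le> K"
    and le: "(\<integral>\<^sup>+x. ennreal ((f x)\<^sup>2) \<partial>M) \<le> ennreal (K\<^sup>2)"
  shows "f \<in> L2 M" and "L2_norm M f \<le> K"
proof -
  have "(\<integral>\<^sup>+x. ennreal (norm ((f x)\<^sup>2)) \<partial>M) < \<infinity>"
    using le by (simp add: order.strict_trans1)
  then have "integrable M (\<lambda>x. (f x)\<^sup>2)"
    by (intro integrableI_bounded) measurable
  then show "f \<in> L2 M" by (simp add: L2_def)
  from nn_integral_L2[OF this] le show "L2_norm M f \<le> K"
    using \<open>0 \<le> K\<close> by (simp add: power2_le_iff_abs_le)
qed

lemma L2_norm_zero_imp_AE:
  assumes "f \<in> L2 M" "L2_norm M f = 0"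
  shows "AE x in M. f x = 0"
proof -
  have "(\<integral>x. (f x)\<^sup>2 \<partial>M) = 0" using assms(2) by (simp add: L2_norm_def)
  then have "AE x in M. (f x)\<^sup>2 = 0"
    using integral_nonneg_eq_0_iff_AE[OF L2_integrable_square[OF assms(1)]] by simp
  then show ?thesis by simp
qed

text \<open>Averaging over a probability space is a contraction from \<open>L\<^sup>\<infinity>(U, L\<^sup>2(M))\<close> to \<open>L\<^sup>2(M)\<close>: Jensen's
  inequality in \<open>\<theta>\<close>, followed by Tonelli. Where \<open>\<lambda>\<theta>. g (t, \<theta>)\<close> is not integrable its integral is
  \<open>0\<close>, so the pointwise inequality holds for these \<open>t\<close> as well.\<close>

lemma L2_average:
  assumes "prob_space U" "sigma_finite_measure M"
    and g[measurable]: "g \<in> borel_measurable (M \<Otimes>\<^sub>M U)" and K: "0 \<le> K"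
    and le: "\<And>\<theta>. \<theta> \<in> space U \<Longrightarrow> (\<integral>\<^sup>+t. ennreal ((g (t, \<theta>))\<^sup>2) \<partial>M) \<le> ennreal (K\<^sup>2)"
  shows "(\<lambda>t. \<integral>\<theta>. g (t, \<theta>) \<partial>U) \<in> L2 M"
    and "L2_norm M (\<lambda>t. \<integral>\<theta>. g (t, \<theta>) \<partial>U) \<le> K"
    and "AE t in M. integrable U (\<lambda>\<theta>. g (t, \<theta>))"
proof -
  interpret U: prob_space U by fact
  interpret M: sigma_finite_measure M by fact
  interpret pair_sigma_finite M U by unfold_locales
  have g2: "(\<lambda>\<theta>. g (t, \<theta>)) \<in> borel_measurable U" if "t \<in> space M" for t
    using that by measurable
  have sq: "integrable U (\<lambda>\<theta>. g (t, \<theta>))" "(\<integral>\<theta>. g (t, \<theta>) \<partial>U)\<^sup>2 \<le> (\<integral>\<theta>. (g (t, \<theta>))\<^sup>2 \<partial>U)"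
    if t: "t \<in> space M" and i: "integrable U (\<lambda>\<theta>. (g (t, \<theta>))\<^sup>2)" for t
  proof -
    show int: "integrable U (\<lambda>\<theta>. g (t, \<theta>))"
      by (rule U.square_integrable_imp_integrable[OF g2[OF t] i])
    show "(\<integral>\<theta>. g (t, \<theta>) \<partial>U)\<^sup>2 \<le> (\<integral>\<theta>. (g (t, \<theta>))\<^sup>2 \<partial>U)"
      using U.variance_eq[OF int i] U.variance_positive[of "\<lambda>\<theta>. g (t, \<theta>)"] by simp
  qed
  have int: "integrable U (\<lambda>\<theta>. (g (t, \<theta>))\<^sup>2)"
    if "t \<in> space M" "(\<integral>\<^sup>+\<theta>. ennreal ((g (t, \<theta>))\<^sup>2) \<partial>U) < \<infinity>" for t
    using that g2[of t] by (intro integrableI_bounded) auto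
  have "(\<integral>\<^sup>+t. \<integral>\<^sup>+\<theta>. ennreal ((g (t, \<theta>))\<^sup>2) \<partial>U \<partial>M) = (\<integral>\<^sup>+\<theta>. \<integral>\<^sup>+t. ennreal ((g (t, \<theta>))\<^sup>2) \<partial>M \<partial>U)"
    by (rule Fubini'[symmetric]) measurable
  also have "\<dots> \<le> (\<integral>\<^sup>+\<theta>. ennreal (K\<^sup>2) \<partial>U)"
    by (rule nn_integral_mono) (rule le)
  also have "\<dots> = ennreal (K\<^sup>2)" by (simp add: U.emeasure_space_1)
  finally have tot: "(\<integral>\<^sup>+t. \<integral>\<^sup>+\<theta>. ennreal ((g (t, \<theta>))\<^sup>2) \<partial>U \<partial>M) \<le> ennreal (K\<^sup>2)" .
  have "AE t in M. (\<integral>\<^sup>+\<theta>. ennreal ((g (t, \<theta>))\<^sup>2) \<partial>U) \<noteq> \<infinity>"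
    using tot by (intro nn_integral_noteq_infinite) (auto simp: top_unique)
  then show "AE t in M. integrable U (\<lambda>\<theta>. g (t, \<theta>))"
    using AE_space by eventually_elim (auto intro!: sq int simp: less_top)
  have pw: "ennreal ((\<integral>\<theta>. g (t, \<theta>) \<partial>U)\<^sup>2) \<le> (\<integral>\<^sup>+\<theta>. ennreal ((g (t, \<theta>))\<^sup>2) \<partial>U)"
    if t: "t \<in> space M" for t
  proof (cases "(\<integral>\<^sup>+\<theta>. ennreal ((g (t, \<theta>))\<^sup>2) \<partial>U) = \<infinity>")
    case False
    then have i: "integrable U (\<lambda>\<theta>. (g (t, \<theta>))\<^sup>2)" using int[OF t] by (simp add: less_top)
    show ?thesis using sq(2)[OF t i] by (simp add: nn_integral_eq_integral[OF i] ennreal_leI)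
  qed simp
  have "(\<integral>\<^sup>+t. ennreal ((\<integral>\<theta>. g (t, \<theta>) \<partial>U)\<^sup>2) \<partial>M) \<le> (\<integral>\<^sup>+t. \<integral>\<^sup>+\<theta>. ennreal ((g (t, \<theta>))\<^sup>2) \<partial>U \<partial>M)"
    by (rule nn_integral_mono) (rule pw)
  with tot have b: "(\<integral>\<^sup>+t. ennreal ((\<integral>\<theta>. g (t, \<theta>) \<partial>U)\<^sup>2) \<partial>M) \<le> ennreal (K\<^sup>2)" by simp
  have m: "(\<lambda>t. \<integral>\<theta>. g (t, \<theta>) \<partial>U) \<in> borel_measurable M"
    by measurable
  show "(\<lambda>t. \<integral>\<theta>. g (t, \<theta>) \<partial>U) \<in> L2 M" "L2_norm M (\<lambda>t. \<integral>\<theta>. g (t, \<theta>) \<partial>U) \<le> K"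
    using L2I_nn_integral[OF m K b] by auto
qed

lemma continuous_linear_functional_L2_inner:
  assumes w: "w \<in> L2 M"
  shows "continuous_linear_functional_L2 M (\<lambda>g. \<integral>x. g x * w x \<partial>M)"
  unfolding continuous_linear_functional_L2_def
proof (intro conjI ballI allI impI)
  fix g h assume g: "g \<in> L2 M" and h: "h \<in> L2 M"
  show "(\<integral>x. (g x + h x) * w x \<partial>M) = (\<integral>x. g x * w x \<partial>M) + (\<integral>x. h x * w x \<partial>M)"
    using L2_integrable_mult[OF g w] L2_integrable_mult[OF h w] by (simp add: distrib_right)
next
  fix a g
  show "(\<integral>x. a * g x * w x \<partial>M) = a * (\<integral>x. g x * w x \<partial>M)"
    by (simp add: mult.assoc)
next
  fix g and e :: real assume g: "g \<in> L2 M" and e: "0 < e"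
  let ?d = "e / (L2_norm M w + 1)"
  have pos: "0 < L2_norm M w + 1" using L2_norm_nonneg[of M w] by simp
  have "\<bar>(\<integral>x. h x * w x \<partial>M) - (\<integral>x. g x * w x \<partial>M)\<bar> < e"
    if h: "h \<in> L2 M" and d: "L2_norm M (\<lambda>x. h x - g x) < ?d" for h
  proof -
    have "\<bar>(\<integral>x. h x * w x \<partial>M) - (\<integral>x. g x * w x \<partial>M)\<bar> = \<bar>\<integral>x. (h x - g x) * w x \<partial>M\<bar>"
      using L2_integrable_mult[OF g w] L2_integrable_mult[OF h w] by (simp add: left_diff_distrib)
    also have "\<dots> \<le> L2_norm M (\<lambda>x. h x - g x) * L2_norm M w"
      by (rule L2_Cauchy_Schwarz[OF L2_diff[OF h g] w])
    also have "\<dots> \<le> L2_norm M (\<lambda>x. h x - g x) * (L2_norm M w + 1)"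
      by (intro mult_left_mono) (auto simp: L2_norm_nonneg)
    also have "\<dots> < e" using d pos by (simp add: pos_less_divide_eq)
    finally show ?thesis .
  qed
  then show "\<exists>d>0. \<forall>h\<in>L2 M. L2_norm M (\<lambda>x. h x - g x) < d \<longrightarrow>
      \<bar>(\<integral>x. h x * w x \<partial>M) - (\<integral>x. g x * w x \<partial>M)\<bar> < e"
    using e pos by (intro exI[of _ ?d]) auto
qed

text \<open>Two closed balls of the same radius, less than half the distance of their centres, lie on opposite sides of a
  hyperplane. The functional is the inner product with \<open>b - a\<close>, the threshold its value at the
  midpoint of \<open>a\<close> and \<open>b\<close>.\<close>

lemma L2_balls_linearly_separable:
  assumes a: "a \<in> L2 M" and b: "b \<in> L2 M" and "0 \<le> r" and r: "2 * r < L2_norm M (\<lambda>x. a x - b x)"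
  obtains \<Phi> \<beta> where "continuous_linear_functional_L2 M \<Phi>"
    and "\<And>f. f \<in> L2 M \<Longrightarrow> L2_norm M (\<lambda>x. f x - a x) \<le> r \<Longrightarrow> \<Phi> f < \<beta>"
    and "\<And>f. f \<in> L2 M \<Longrightarrow> L2_norm M (\<lambda>x. f x - b x) \<le> r \<Longrightarrow> \<beta> < \<Phi> f"
proof -
  define w where "w = (\<lambda>x. b x - a x)"
  define \<Phi> where "\<Phi> = (\<lambda>g. \<integral>x. g x * w x \<partial>M)"
  define D where "D = L2_norm M w"
  have w: "w \<in> L2 M" unfolding w_def by (rule L2_diff[OF b a])
  have D: "2 * r < D" using r unfolding D_def w_def by (subst L2_norm_minus_commute)
  then have "0 < D" using \<open>0 \<le> r\<close> by simp
  have diff: "\<Phi> f - \<Phi> g = (\<integral>x. (f x - g x) * w x \<partial>M)" if "f \<in> L2 M" "g \<in> L2 M" for f g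
    using L2_integrable_mult[OF that(1) w] L2_integrable_mult[OF that(2) w]
    by (simp add: \<Phi>_def left_diff_distrib)
  have dist: "\<bar>\<Phi> f - \<Phi> g\<bar> < D\<^sup>2 / 2"
    if f: "f \<in> L2 M" and g: "g \<in> L2 M" and fg: "L2_norm M (\<lambda>x. f x - g x) \<le> r" for f g
  proof -
    have "\<bar>\<Phi> f - \<Phi> g\<bar> \<le> L2_norm M (\<lambda>x. f x - g x) * D"
      unfolding diff[OF f g] D_def by (rule L2_Cauchy_Schwarz[OF L2_diff[OF f g] w])
    also have "\<dots> \<le> r * D" using fg \<open>0 < D\<close> by (simp add: mult_right_mono)
    also have "\<dots> < D\<^sup>2 / 2" using D \<open>0 < D\<close> by (simp add: power2_eq_square)
    finally show ?thesis .
  qed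
  have "\<Phi> b - \<Phi> a = D\<^sup>2"
    unfolding diff[OF b a] D_def L2_norm_square by (simp add: w_def power2_eq_square)
  show ?thesis
  proof (rule that)
    show "continuous_linear_functional_L2 M \<Phi>"
      unfolding \<Phi>_def by (rule continuous_linear_functional_L2_inner[OF w])
    fix f assume f: "f \<in> L2 M"
    show "\<Phi> f < \<Phi> a + D\<^sup>2 / 2" if "L2_norm M (\<lambda>x. f x - a x) \<le> r"
      using dist[OF f a that] by linarith
    show "\<Phi> a + D\<^sup>2 / 2 < \<Phi> f" if "L2_norm M (\<lambda>x. f x - b x) \<le> r"
      using dist[OF f b that] \<open>\<Phi> b - \<Phi> a = D\<^sup>2\<close> by linarith
  qed
qed

section \<open>Quantiles and optimal transport on the line\<close>

text \<open>A real \<open>q\<close> is the quantile at level \<open>u\<close> as soon as the distribution function crosses \<open>u\<close> at \<open>q\<close>;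
  on which side of the level the value at \<open>q\<close> itself lies does not matter.\<close>

lemma quantile_eqI:
  fixes q :: real
  assumes above: "\<And>s. q < s \<Longrightarrow> u < cdf \<nu> s" and below: "\<And>s. s < q \<Longrightarrow> cdf \<nu> s \<le> u"
  shows "quantile \<nu> u = ereal q"
proof (rule antisym)
  show "ereal q \<le> quantile \<nu> u"
    unfolding quantile_def
  proof (rule INF_greatest)
    fix s assume "s \<in> {s. cdf \<nu> s > u}"
    then show "ereal q \<le> ereal s" using below[of s] by (cases "s < q") auto
  qed
  show "quantile \<nu> u \<le> ereal q"
  proof (rule ereal_le_epsilon2)
    fix e :: real assume "0 < e"
    then have "quantile \<nu> u \<le> ereal (q + e)"
      unfolding quantile_def by (intro INF_lower) (simp add: above)
    then show "quantile \<nu> u \<le> ereal q + ereal e" by simp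
  qed
qed

lemma (in real_distribution) quantile_finite:
  assumes u: "0 < u" "u < 1"
  obtains q where "quantile M u = ereal q"
    and "\<And>s. q < s \<Longrightarrow> u < cdf M s" and "\<And>s. s < q \<Longrightarrow> cdf M s \<le> u"
proof -
  define S where "S = {s. cdf M s > u}"
  obtain s1 where s1: "u < cdf M s1"
    using order_tendstoD(1)[OF cdf_lim_at_top_prob u(2)]
    by (auto dest!: eventually_happens'[OF trivial_limit_at_top_linorder])
  obtain s0 where s0: "cdf M s0 < u"
    using order_tendstoD(2)[OF cdf_lim_at_bot u(1)]
    by (auto dest!: eventually_happens'[OF trivial_limit_at_bot_linorder])
  have ne: "S \<noteq> {}" using s1 by (auto simp: S_def)
  have bdd: "bdd_below S"
  proof (rule bdd_belowI[of _ s0])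
    fix s assume "s \<in> S"
    then show "s0 \<le> s"
      using s0 cdf_nondecreasing[of s s0] by (cases "s \<le> s0") (auto simp: S_def)
  qed
  have above: "u < cdf M s" if "Inf S < s" for s
  proof -
    obtain r where "r \<in> S" "r < s" using cInf_lessD[OF ne \<open>Inf S < s\<close>] by blast
    then show ?thesis using cdf_nondecreasing[of r s] by (auto simp: S_def)
  qed
  have below: "cdf M s \<le> u" if "s < Inf S" for s
    using cInf_lower[OF _ bdd, of s] that by (force simp: S_def)
  show ?thesis
    using that[OF quantile_eqI[OF above below]] above below by blast
qed

lemma borel_measurable_quantile:
  assumes K: "\<And>s. (\<lambda>x. cdf (K x) s) \<in> borel_measurable N"
    and u[measurable]: "u \<in> borel_measurable N"
    and mono: "\<And>x s s'. x \<in> space N \<Longrightarrow> s \<le> s' \<Longrightarrow> cdf (K x) s \<le> cdf (K x) s'"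
  shows "(\<lambda>x. quantile (K x) (u x)) \<in> borel_measurable N"
proof (rule borel_measurableI_less)
  fix y :: ereal
  note K[measurable]
  have "quantile (K x) (u x) < y \<longleftrightarrow> (\<exists>r::rat. ereal (of_rat r) < y \<and> u x < cdf (K x) (of_rat r))"
    if x: "x \<in> space N" for x
  proof
    assume "quantile (K x) (u x) < y"
    then obtain s where s: "u x < cdf (K x) s" "ereal s < y"
      by (auto simp: quantile_def INF_less_iff)
    obtain s' where s': "ereal s < s'" "s' < y" using dense[OF s(2)] by blast
    then obtain w where w: "s < w" "ereal w \<le> s'"
      by (cases s') (auto intro: that[of "s + 1"])
    obtain r where r: "s < of_rat r" "of_rat r < w" using of_rat_dense[OF w(1)] by blast
    have "ereal (of_rat r) < y"
      using r(2) w(2) s'(2) by (metis ereal_less_eq(3) less_imp_le order.trans order.strict_trans1)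
    moreover have "u x < cdf (K x) (of_rat r)"
      using s(1) mono[OF x, of s "of_rat r"] r(1) by simp
    ultimately show "\<exists>r::rat. ereal (of_rat r) < y \<and> u x < cdf (K x) (of_rat r)" by blast
  next
    assume "\<exists>r::rat. ereal (of_rat r) < y \<and> u x < cdf (K x) (of_rat r)"
    then show "quantile (K x) (u x) < y"
      by (auto simp: quantile_def INF_less_iff)
  qed
  then have "{x \<in> space N. quantile (K x) (u x) < y} =
     {x \<in> space N. \<exists>r::rat. ereal (of_rat r) < y \<and> u x < cdf (K x) (of_rat r)}" by blast
  also have "\<dots> \<in> sets N" by measurable
  finally show "{x \<in> space N. quantile (K x) (u x) < y} \<in> sets N" .
qed

text \<open>The reference measure. A distribution without atoms has a continuous distribution function, and
  \<open>cdt\<close> transports it onto any given distribution.\<close>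

locale atomless_distribution = real_distribution M for M +
  assumes atomless: "measure M {t} = 0"
begin

lemma measurable_cdf[measurable]: "cdf M \<in> borel_measurable borel"
  by (intro borel_measurable_mono monoI cdf_nondecreasing)

text \<open>The probability integral transform: the distribution function pushes \<open>M\<close> to the uniform
  distribution on the unit interval. As \<open>M\<close> is the image of the uniform distribution under the
  left-continuous quantile function \<open>I\<close>, it suffices that \<open>C (I \<omega>) = \<omega>\<close> for continuous \<open>C\<close>.\<close>

lemma distr_cdf: "distr M borel (cdf M) = distr (restrict_space lborel {0<..<1}) borel (\<lambda>u. u)"
proof -
  interpret cdf_distribution M by unfold_locales
  let ?\<Omega> = "restrict_space lborel {0<..<1::real}"
  have CI: "C (I \<omega>) = \<omega>" if \<omega>: "0 < \<omega>" "\<omega> < 1" for \<omega>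
  proof (rule antisym)
    show "\<omega> \<le> C (I \<omega>)" by (rule iffD2[OF pseudoinverse[OF \<omega>] order_refl])
    show "C (I \<omega>) \<le> \<omega>"
    proof (rule ccontr)
      assume *: "\<not> C (I \<omega>) \<le> \<omega>"
      have "isCont C (I \<omega>)" by (simp add: isCont_cdf atomless)
      then have "(C \<longlongrightarrow> C (I \<omega>)) (at_left (I \<omega>))"
        unfolding isCont_def by (rule filterlim_mono[OF _ order_refl at_le]) simp
      from order_tendstoD(1)[OF this, of \<omega>] have "eventually (\<lambda>x. \<omega> < C x) (at_left (I \<omega>))"
        using * by linarith
      moreover have "eventually (\<lambda>x. x < I \<omega>) (at_left (I \<omega>))"
        by (simp add: eventually_at_filter)
      ultimately have "eventually (\<lambda>x. \<omega> < C x \<and> x < I \<omega>) (at_left (I \<omega>))"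
        by eventually_elim auto
      then obtain x where "\<omega> < C x" "x < I \<omega>"
        by (auto dest!: eventually_happens'[OF trivial_limit_at_left_real])
      then show False using iffD1[OF pseudoinverse[OF \<omega>, of x]] by linarith
    qed
  qed
  have "distr M borel C = distr (distr ?\<Omega> borel I) borel C" by (simp add: distr_I_eq_M)
  also have "\<dots> = distr ?\<Omega> borel (C \<circ> I)"
    proof (rule distr_distr)
    show "I \<in> measurable ?\<Omega> borel"
      using measurable_CI by (subst measurable_cong_sets[OF sets_restrict_space_cong[OF sets_lborel] refl])
  qed (rule measurable_C)
  also have "\<dots> = distr ?\<Omega> borel (\<lambda>u. u)"
  proof (rule distr_cong)
    fix \<omega> assume "\<omega> \<in> space ?\<Omega>"
    then have "0 < \<omega>" "\<omega> < 1" by (auto simp: space_restrict_space)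
    then show "(C \<circ> I) \<omega> = \<omega>" unfolding o_def by (rule CI)
  qed simp_all
  finally show ?thesis .
qed

lemma measure_cdf_vimage:
  assumes [measurable]: "A \<in> sets borel"
  shows "measure M {t. cdf M t \<in> A} = measure lborel (A \<inter> {0<..<1})"
proof -
  have "measure M {t. cdf M t \<in> A} = measure (distr M borel (cdf M)) A"
    by (subst measure_distr) (auto simp: vimage_def)
  also have "\<dots> = measure (restrict_space lborel {0<..<1}) (A \<inter> {0<..<1})"
    unfolding distr_cdf by (subst measure_distr) (auto simp: space_restrict_space Int_commute intro!: measurable_restrict_space1)
  also have "\<dots> = measure lborel (A \<inter> {0<..<1})"
    by (subst measure_restrict_space) auto
  finally show ?thesis .
qed

lemma measure_cdf_le: "0 \<le> p \<Longrightarrow> p \<le> 1 \<Longrightarrow> measure M {t. cdf M t \<le> p} = p"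
proof -
  assume p: "0 \<le> p" "p \<le> 1"
  have "measure M {t. cdf M t \<in> {..p}} = measure lborel ({..p} \<inter> {0<..<1})"
    by (rule measure_cdf_vimage) simp
  also have "{..p} \<inter> {0<..<1} = (if p = 1 then {0<..<1} else {0<..p})" using p by auto
  finally show ?thesis using p by (auto split: if_splits)
qed

lemma measure_cdf_less: "0 \<le> p \<Longrightarrow> p \<le> 1 \<Longrightarrow> measure M {t. cdf M t < p} = p"
proof -
  assume p: "0 \<le> p" "p \<le> 1"
  have "measure M {t. cdf M t \<in> {..<p}} = measure lborel ({..<p} \<inter> {0<..<1})"
    by (rule measure_cdf_vimage) simp
  also have "{..<p} \<inter> {0<..<1} = {0<..<p}" using p by auto
  finally show ?thesis using p by auto
qed

lemma AE_cdf_01: "AE t in M. 0 < cdf M t \<and> cdf M t < 1"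
proof -
  have "measure M {t. cdf M t \<in> {0<..<1}} = 1"
    by (subst measure_cdf_vimage) auto
  then have "AE t in M. t \<in> {t. cdf M t \<in> {0<..<1}}"
    by (subst prob_eq_1[symmetric]) auto
  then show ?thesis by simp
qed

lemma measurable_cdt:
  assumes "real_distribution \<nu>"
  shows "cdt M \<nu> \<in> borel_measurable borel"
proof -
  interpret N: real_distribution \<nu> by fact
  have [measurable]: "(\<lambda>t. quantile \<nu> (cdf M t)) \<in> borel_measurable borel"
    by (rule borel_measurable_quantile) (auto intro: N.cdf_nondecreasing)
  show ?thesis unfolding cdt_def[abs_def] by measurable
qed

lemma cdt_char:
  assumes "real_distribution \<nu>" and "0 < cdf M t" "cdf M t < 1"
  shows "cdt M \<nu> t < s \<Longrightarrow> cdf M t < cdf \<nu> s" and "s < cdt M \<nu> t \<Longrightarrow> cdf \<nu> s \<le> cdf M t"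
proof -
  interpret N: real_distribution \<nu> by fact
  obtain q where q: "quantile \<nu> (cdf M t) = ereal q"
    "\<And>s. q < s \<Longrightarrow> cdf M t < cdf \<nu> s" "\<And>s. s < q \<Longrightarrow> cdf \<nu> s \<le> cdf M t"
    using N.quantile_finite[OF assms(2,3)] by blast
  have "cdt M \<nu> t = q" by (simp add: cdt_def q(1))
  then show "cdt M \<nu> t < s \<Longrightarrow> cdf M t < cdf \<nu> s" "s < cdt M \<nu> t \<Longrightarrow> cdf \<nu> s \<le> cdf M t"
    using q by auto
qed

lemma cdt_eqI:
  assumes "\<And>s. q < s \<Longrightarrow> cdf M t < cdf \<nu> s" "\<And>s. s < q \<Longrightarrow> cdf \<nu> s \<le> cdf M t"
  shows "cdt M \<nu> t = q"
  using quantile_eqI[OF assms] by (simp add: cdt_def)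

text \<open>Up to a null set, the sublevel set of \<open>cdt M \<nu>\<close> at \<open>a\<close> lies between \<open>{cdf M < cdf \<nu> a}\<close> and \<open>{cdf M \<le> cdf \<nu> a}\<close>. The
  difference of the two is a null set because \<open>cdf M\<close> is uniformly distributed.\<close>

lemma cdt_le_bounds:
  assumes "real_distribution \<nu>" and "0 < cdf M t" "cdf M t < 1"
  shows "cdf M t < cdf \<nu> a \<Longrightarrow> cdt M \<nu> t \<le> a" and "cdt M \<nu> t \<le> a \<Longrightarrow> cdf M t \<le> cdf \<nu> a"
proof -
  interpret N: real_distribution \<nu> by fact
  show "cdf M t < cdf \<nu> a \<Longrightarrow> cdt M \<nu> t \<le> a"
    using cdt_char(2)[OF assms, of a] by (cases "cdt M \<nu> t \<le> a") auto
  assume le: "cdt M \<nu> t \<le> a"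
  have "(cdf \<nu> \<longlongrightarrow> cdf \<nu> a) (at_right a)"
    using N.cdf_is_right_cont by (simp add: continuous_within)
  moreover have "eventually (\<lambda>s. cdf M t \<le> cdf \<nu> s) (at_right a)"
    unfolding eventually_at_filter
    using cdt_char(1)[OF assms] le by (intro always_eventually) (auto intro!: less_imp_le)
  ultimately show "cdf M t \<le> cdf \<nu> a"
    by (rule tendsto_lowerbound) (rule trivial_limit_at_right_real)
qed

lemma distr_cdt:
  assumes "real_distribution \<nu>"
  shows "distr M borel (cdt M \<nu>) = \<nu>"
proof (rule cdf_unique)
  interpret N: real_distribution \<nu> by fact
  note [measurable] = measurable_cdt[OF assms]
  show "real_distribution (distr M borel (cdt M \<nu>))" by (rule real_distribution_distr) simp
  show "real_distribution \<nu>" by fact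
  show "cdf (distr M borel (cdt M \<nu>)) = cdf \<nu>"
  proof
    fix a
    have p: "0 \<le> cdf \<nu> a" "cdf \<nu> a \<le> 1" using N.cdf_nonneg N.cdf_bounded_prob by auto
    have "cdf (distr M borel (cdt M \<nu>)) a = measure M {t. cdt M \<nu> t \<le> a}"
      unfolding cdf_def by (subst measure_distr) (auto simp: vimage_def)
    moreover have "measure M {t. cdf M t < cdf \<nu> a} \<le> measure M {t. cdt M \<nu> t \<le> a}"
      by (rule finite_measure_mono_AE)
         (use AE_cdf_01 cdt_le_bounds(1)[OF assms] in auto)
    moreover have "measure M {t. cdt M \<nu> t \<le> a} \<le> measure M {t. cdf M t \<le> cdf \<nu> a}"
      by (rule finite_measure_mono_AE)
         (use AE_cdf_01 cdt_le_bounds(2)[OF assms] in auto)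
    ultimately show "cdf (distr M borel (cdt M \<nu>)) a = cdf \<nu> a"
      using measure_cdf_le[OF p] measure_cdf_less[OF p] by linarith
  qed
qed

lemma cdt_affine:
  assumes "real_distribution \<nu>" and "0 < cdf M t" "cdf M t < 1" and "0 < a"
  shows "cdt M (distr \<nu> borel (\<lambda>x. a * x + b)) t = a * cdt M \<nu> t + b"
proof -
  interpret N: real_distribution \<nu> by fact
  have cdf: "cdf (distr \<nu> borel (\<lambda>x. a * x + b)) s = cdf \<nu> ((s - b) / a)" for s
    unfolding cdf_def using \<open>0 < a\<close>
    by (subst measure_distr) (auto simp: vimage_def field_simps intro!: arg_cong[where f="measure \<nu>"])
  show ?thesis
  proof (rule cdt_eqI, unfold cdf)
    fix s
    show "cdf M t < cdf \<nu> ((s - b) / a)" if "a * cdt M \<nu> t + b < s"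
      by (rule cdt_char(1)[OF assms(1-3)]) (use that \<open>0 < a\<close> in \<open>simp add: field_simps\<close>)
    show "cdf \<nu> ((s - b) / a) \<le> cdf M t" if "s < a * cdt M \<nu> t + b"
      by (rule cdt_char(2)[OF assms(1-3)]) (use that \<open>0 < a\<close> in \<open>simp add: field_simps\<close>)
  qed
qed

end

text \<open>The quadratic cost as a superposition of the probabilities that one variable is small and the other
  large: for \<open>x < y\<close>, \<open>(y - x)\<^sup>2\<close> is the area of the square of all \<open>(s, t)\<close> with both coordinates in
  \<open>[x, y)\<close>, that is, with \<open>x \<le> min s t\<close> and \<open>max s t < y\<close>.\<close>

lemma nn_integral_square_diff:
  assumes "sigma_finite_measure P" and [measurable]: "X \<in> borel_measurable P" "Y \<in> borel_measurable P"
  shows "(\<integral>\<^sup>+x. ennreal ((X x - Y x)\<^sup>2) \<partial>P) =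
    (\<integral>\<^sup>+s. \<integral>\<^sup>+t. emeasure P {x \<in> space P. X x \<le> min s t \<and> max s t < Y x}
        + emeasure P {x \<in> space P. Y x \<le> min s t \<and> max s t < X x} \<partial>lborel \<partial>lborel)"
proof -
  interpret P: sigma_finite_measure P by fact
  interpret PL: pair_sigma_finite P lborel by unfold_locales
  let ?f = "\<lambda>(x::real) y (s::real) t. indicator {s. x \<le> s \<and> s < y} s * indicator {s. x \<le> s \<and> s < y} t :: ennreal"
  have half: "(\<integral>\<^sup>+s. \<integral>\<^sup>+t. ?f x y s t \<partial>lborel \<partial>lborel) = ennreal ((max 0 (y - x))\<^sup>2)" for x y
  proof -
    have "{s. x \<le> s \<and> s < y} = {x..<y}" by auto
    then show ?thesis
      by (simp add: nn_integral_cmult nn_integral_multc ennreal_mult''[symmetric] power2_eq_square max_def)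
  qed
  have "ennreal ((X x - Y x)\<^sup>2) =
     (\<integral>\<^sup>+s. \<integral>\<^sup>+t. ?f (X x) (Y x) s t + ?f (Y x) (X x) s t \<partial>lborel \<partial>lborel)" for x
  proof -
    have "(\<integral>\<^sup>+s. \<integral>\<^sup>+t. ?f (X x) (Y x) s t + ?f (Y x) (X x) s t \<partial>lborel \<partial>lborel)
      = ennreal ((max 0 (Y x - X x))\<^sup>2) + ennreal ((max 0 (X x - Y x))\<^sup>2)"
      by (subst nn_integral_add, measurable, subst nn_integral_add, measurable, simp only: half)
    also have "\<dots> = ennreal ((X x - Y x)\<^sup>2)"
      by (auto simp: max_def power2_commute)
    finally show ?thesis by simp
  qed
  then have "(\<integral>\<^sup>+x. ennreal ((X x - Y x)\<^sup>2) \<partial>P) =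
     (\<integral>\<^sup>+x. \<integral>\<^sup>+s. \<integral>\<^sup>+t. ?f (X x) (Y x) s t + ?f (Y x) (X x) s t \<partial>lborel \<partial>lborel \<partial>P)" by simp
  also have "\<dots> = (\<integral>\<^sup>+s. \<integral>\<^sup>+x. \<integral>\<^sup>+t. ?f (X x) (Y x) s t + ?f (Y x) (X x) s t \<partial>lborel \<partial>P \<partial>lborel)"
    by (rule PL.Fubini'[symmetric]) measurable
  also have "\<dots> = (\<integral>\<^sup>+s. \<integral>\<^sup>+t. \<integral>\<^sup>+x. ?f (X x) (Y x) s t + ?f (Y x) (X x) s t \<partial>P \<partial>lborel \<partial>lborel)"
    by (intro nn_integral_cong PL.Fubini'[symmetric]) measurable
  also have "\<dots> = (\<integral>\<^sup>+s. \<integral>\<^sup>+t. \<integral>\<^sup>+x. indicator {x \<in> space P. X x \<le> min s t \<and> max s t < Y x} x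
        + indicator {x \<in> space P. Y x \<le> min s t \<and> max s t < X x} x \<partial>P \<partial>lborel \<partial>lborel)"
    by (intro nn_integral_cong) (auto split: split_indicator)
  also have "\<dots> = (\<integral>\<^sup>+s. \<integral>\<^sup>+t. emeasure P {x \<in> space P. X x \<le> min s t \<and> max s t < Y x}
        + emeasure P {x \<in> space P. Y x \<le> min s t \<and> max s t < X x} \<partial>lborel \<partial>lborel)"
    by (intro nn_integral_cong, subst nn_integral_add) auto
  finally show ?thesis .
qed

context atomless_distribution
begin

text \<open>Any coupling satisfies \<open>P(X \<le> a, Y > b) \<ge> P(X \<le> a) - P(Y \<le> b)\<close>; the quantile coupling attains the
  positive part of the right-hand side.\<close>

lemma monotone_coupling_prob_le:
  assumes "prob_space P" and X[measurable]: "X \<in> borel_measurable P" and Y[measurable]: "Y \<in> borel_measurable P"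
  shows "emeasure M {t. cdt M (distr P borel X) t \<le> a \<and> b < cdt M (distr P borel Y) t}
     \<le> emeasure P {x \<in> space P. X x \<le> a \<and> b < Y x}"
proof -
  interpret P: prob_space P by fact
  let ?F = "cdf (distr P borel X) a" and ?G = "cdf (distr P borel Y) b"
  have rX: "real_distribution (distr P borel X)" and rY: "real_distribution (distr P borel Y)"
    by (rule P.real_distribution_distr, simp)+
  interpret DX: real_distribution "distr P borel X" by fact
  interpret DY: real_distribution "distr P borel Y" by fact
  note [measurable] = measurable_cdt[OF rX] measurable_cdt[OF rY]
  have F: "?F = P.prob {x \<in> space P. X x \<le> a}" and G: "?G = P.prob {x \<in> space P. Y x \<le> b}"
    unfolding cdf_def by (subst measure_distr, auto simp: vimage_def Int_def conj_commute)+
  have "measure M {t. cdt M (distr P borel X) t \<le> a \<and> b < cdt M (distr P borel Y) t}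
    \<le> measure M ({t. cdf M t \<le> ?F} - {t. cdf M t < ?G})"
  proof (rule finite_measure_mono_AE)
    show "AE t in M. t \<in> {t. cdt M (distr P borel X) t \<le> a \<and> b < cdt M (distr P borel Y) t} \<longrightarrow>
       t \<in> {t. cdf M t \<le> ?F} - {t. cdf M t < ?G}"
      using AE_cdf_01
    proof eventually_elim
      case (elim t)
      then show ?case
        using cdt_le_bounds(2)[OF rX, of t a] cdt_le_bounds(1)[OF rY, of t b] by auto
    qed
  qed measurable
  also have "\<dots> \<le> max 0 (?F - ?G)"
  proof (cases "?G \<le> ?F")
    case True
    have "measure M ({t. cdf M t \<le> ?F} - {t. cdf M t < ?G}) = 
       measure M {t. cdf M t \<le> ?F} - measure M {t. cdf M t < ?G}"
      by (rule finite_measure_Diff) (use True in auto)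
    then show ?thesis
      using measure_cdf_le[OF DX.cdf_nonneg DX.cdf_bounded_prob, of a]
        measure_cdf_less[OF DY.cdf_nonneg DY.cdf_bounded_prob, of b] by simp
  next
    case False
    then have "{t. cdf M t \<le> ?F} - {t. cdf M t < ?G} = {}" by auto
    then show ?thesis by (simp only: measure_empty max.cobounded1)
  qed
  also have "\<dots> \<le> P.prob {x \<in> space P. X x \<le> a \<and> b < Y x}"
  proof -
    have "P.prob {x \<in> space P. X x \<le> a} \<le>
       P.prob ({x \<in> space P. X x \<le> a \<and> b < Y x} \<union> {x \<in> space P. Y x \<le> b})"
      by (rule P.finite_measure_mono) auto
    also have "\<dots> \<le> P.prob {x \<in> space P. X x \<le> a \<and> b < Y x} + P.prob {x \<in> space P. Y x \<le> b}"
      by (rule measure_Un_le) auto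
    finally show ?thesis by (simp add: F G)
  qed
  finally show ?thesis
    by (simp add: emeasure_eq_measure P.emeasure_eq_measure)
qed

text \<open>Optimality of the quantile coupling for the quadratic cost: by \<open>nn_integral_square_diff\<close> it
  suffices to compare the probabilities in \<open>monotone_coupling_prob_le\<close>.\<close>

lemma monotone_coupling_optimal:
  assumes "prob_space P" and X[measurable]: "X \<in> borel_measurable P" and Y[measurable]: "Y \<in> borel_measurable P"
  shows "(\<integral>\<^sup>+t. ennreal ((cdt M (distr P borel X) t - cdt M (distr P borel Y) t)\<^sup>2) \<partial>M)
     \<le> (\<integral>\<^sup>+x. ennreal ((X x - Y x)\<^sup>2) \<partial>P)"
proof -
  interpret P: prob_space P by fact
  have [measurable]: "cdt M (distr P borel X) \<in> borel_measurable M" 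
     "cdt M (distr P borel Y) \<in> borel_measurable M"
    using measurable_cdt P.real_distribution_distr by auto
  show ?thesis
    unfolding nn_integral_square_diff[OF sigma_finite_measure_axioms
        \<open>cdt M (distr P borel X) \<in> borel_measurable M\<close> \<open>cdt M (distr P borel Y) \<in> borel_measurable M\<close>]
      nn_integral_square_diff[OF P.sigma_finite_measure_axioms X Y]
    using monotone_coupling_prob_le[OF assms] monotone_coupling_prob_le[OF assms(1,3,2)]
    by (intro nn_integral_mono add_mono) (simp_all only: space_eq_univ UNIV_I simp_thms)
qed

end

section \<open>The uniform measure on the circle under linear maps\<close>

text \<open>The unit-speed parametrization of the circle.\<close>

definition circ :: "real \<Rightarrow> real^2" where
  "circ \<phi> = vector [cos \<phi>, sin \<phi>]"

lemma circ_nth[simp]: "circ \<phi> $ 1 = cos \<phi>" "circ \<phi> $ 2 = sin \<phi>"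
  by (simp_all add: circ_def)

lemma borel_measurable_matrix_vector_mult:
  "(\<lambda>x. B *v x) \<in> borel_measurable (borel :: (real^2) measure)" for B :: "real^2^2"
proof -
  have "continuous_on UNIV ((*v) B)"
    by (rule linear_continuous_on) (simp add: matrix_vector_mul_bounded_linear)
  then show ?thesis by (rule borel_measurable_continuous_onI)
qed

lemma matrix_vector_mult_eq_0D:
  fixes B :: "real^2^2"
  assumes "det B \<noteq> 0" "B *v v = 0"
  shows "v = 0"
  using assms by (metis invertible_det_nz matrix_left_invertible_ker invertible_def)

lemma norm_vec2: "norm (v :: real^2) = sqrt ((v$1)\<^sup>2 + (v$2)\<^sup>2)"
  by (simp add: norm_eq_sqrt_inner inner_vec_def UNIV_2 power2_eq_square)

lemma norm_circ[simp]: "norm (circ \<phi>) = 1"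
  by (simp add: norm_vec2)

lemma circ_periodic: "circ (\<phi> + 2 * pi) = circ \<phi>"
  by (simp add: vec_eq_iff forall_2)

lemma measurable_circ: "circ \<in> borel \<rightarrow>\<^sub>M restrict_space borel S1"
proof (rule measurable_restrict_space2)
  have "circ = (\<lambda>\<phi>. cos \<phi> *\<^sub>R axis 1 1 + sin \<phi> *\<^sub>R axis 2 1)"
    by (auto simp: fun_eq_iff vec_eq_iff forall_2 axis_def)
  then show "circ \<in> borel \<rightarrow>\<^sub>M borel"
    by (rule ssubst) (intro borel_measurable_continuous_onI continuous_intros)
qed auto

lemma space_unif_S1[simp]: "space unif_S1 = S1"
  by (simp add: unif_S1_def arclength_S1_def space_restrict_space space_scale_measure)

lemma sets_unif_S1[measurable_cong]: "sets unif_S1 = sets (restrict_space borel S1)"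
  by (simp add: unif_S1_def arclength_S1_def)

lemma borel_measurable_unif_S1I:
  "f \<in> borel_measurable borel \<Longrightarrow> f \<in> borel_measurable unif_S1"
  unfolding measurable_cong_sets[OF sets_unif_S1 refl] by (rule measurable_restrict_space1)

lemma nn_integral_unif_S1:
  assumes [measurable]: "f \<in> borel_measurable unif_S1"
  shows "(\<integral>\<^sup>+\<theta>. f \<theta> \<partial>unif_S1) =
     ennreal (1 / (2 * pi)) * (\<integral>\<^sup>+\<phi>. f (circ \<phi>) * indicator {0..<2 * pi} \<phi> \<partial>lborel)"
proof -
  have f: "f \<in> borel_measurable (restrict_space borel S1)"
    using assms by (simp add: measurable_cong_sets[OF sets_unif_S1 refl])
  have c: "circ \<in> restrict_space lborel {0..<2 * pi} \<rightarrow>\<^sub>M restrict_space borel S1"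
    by (rule measurable_restrict_space1) (simp add: measurable_circ measurable_lborel1)
  have "arclength_S1 = distr (restrict_space lborel {0..<2 * pi}) (restrict_space borel S1) circ"
    unfolding arclength_S1_def by (rule arg_cong[where f="distr _ _"]) (simp add: fun_eq_iff circ_def)
  then have "(\<integral>\<^sup>+\<theta>. f \<theta> \<partial>unif_S1) = ennreal (1 / (2 * pi)) *
     (\<integral>\<^sup>+\<theta>. f \<theta> \<partial>distr (restrict_space lborel {0..<2 * pi}) (restrict_space borel S1) circ)"
    unfolding unif_S1_def using f by (subst nn_integral_scale_measure) (simp_all add: arclength_S1_def)
  also have "\<dots> = ennreal (1 / (2 * pi)) * (\<integral>\<^sup>+\<phi>. f (circ \<phi>) \<partial>restrict_space lborel {0..<2 * pi})"
    by (subst nn_integral_distr[OF c]) (use f in simp_all)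
  also have "\<dots> = ennreal (1 / (2 * pi)) * (\<integral>\<^sup>+\<phi>. f (circ \<phi>) * indicator {0..<2 * pi} \<phi> \<partial>lborel)"
    by (subst nn_integral_restrict_space) simp_all
  finally show ?thesis .
qed

lemma prob_space_unif_S1: "prob_space unif_S1"
proof (rule prob_spaceI)
  have "emeasure unif_S1 (space unif_S1) = (\<integral>\<^sup>+\<theta>. 1 \<partial>unif_S1)" by simp
  also have "\<dots> = ennreal (1 / (2 * pi)) * (\<integral>\<^sup>+\<phi>. indicator {0..<2 * pi} \<phi> \<partial>lborel)"
    by (subst nn_integral_unif_S1) auto
  also have "\<dots> = 1" by (simp add: ennreal_mult[symmetric])
  finally show "emeasure unif_S1 (space unif_S1) = 1" .
qed

lemma nn_integral_periodic_shift:
  fixes g :: "real \<Rightarrow> ennreal"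
  assumes [measurable]: "g \<in> borel_measurable borel" and per: "\<And>x. g (x + p) = g x" and a: "0 \<le> a" "a \<le> p"
  shows "(\<integral>\<^sup>+x. g x * indicator {a..<a + p} x \<partial>lborel) = (\<integral>\<^sup>+x. g x * indicator {0..<p} x \<partial>lborel)"
proof -
  have "(\<integral>\<^sup>+x. g x * indicator {p..<p + a} x \<partial>lborel) = (\<integral>\<^sup>+x. g (p + x) * indicator {p..<p + a} (p + x) \<partial>lborel)"
    by (subst nn_integral_real_affine[where c=1 and t=p]) auto
  also have "\<dots> = (\<integral>\<^sup>+x. g x * indicator {0..<a} x \<partial>lborel)"
    by (intro nn_integral_cong) (auto simp: per add.commute[of p] split: split_indicator)
  finally have shift: "(\<integral>\<^sup>+x. g x * indicator {p..<p + a} x \<partial>lborel) = (\<integral>\<^sup>+x. g x * indicator {0..<a} x \<partial>lborel)" .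
  have "(\<integral>\<^sup>+x. g x * indicator {a..<a + p} x \<partial>lborel) =
     (\<integral>\<^sup>+x. g x * indicator {a..<p} x + g x * indicator {p..<p + a} x \<partial>lborel)"
    using a by (intro nn_integral_cong) (auto split: split_indicator)
  also have "\<dots> = (\<integral>\<^sup>+x. g x * indicator {a..<p} x \<partial>lborel) + (\<integral>\<^sup>+x. g x * indicator {0..<a} x \<partial>lborel)"
    by (subst nn_integral_add) (auto simp: shift)
  also have "\<dots> = (\<integral>\<^sup>+x. g x * indicator {a..<p} x + g x * indicator {0..<a} x \<partial>lborel)"
    by (subst nn_integral_add) auto
  also have "\<dots> = (\<integral>\<^sup>+x. g x * indicator {0..<p} x \<partial>lborel)"
    using a by (intro nn_integral_cong) (auto split: split_indicator)
  finally show ?thesis .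
qed

lemma nn_integral_periodic_isometry:
  fixes g :: "real \<Rightarrow> ennreal"
  assumes g[measurable]: "g \<in> borel_measurable borel" and per: "\<And>x. g (x + p) = g x"
    and a: "0 \<le> a" "a \<le> p" and s: "s = 1 \<or> s = - 1"
  shows "(\<integral>\<^sup>+x. g (a + s * x) * indicator {0..p} x \<partial>lborel) = (\<integral>\<^sup>+x. g x * indicator {0..<p} x \<partial>lborel)"
  using s
proof
  assume s: "s = 1"
  have "(\<integral>\<^sup>+x. g (a + s * x) * indicator {0..p} x \<partial>lborel) = (\<integral>\<^sup>+x. g (a + 1 * x) * indicator {a..<a + p} (a + 1 * x) \<partial>lborel)"
  proof (rule nn_integral_cong_AE)
    show "AE x in lborel. g (a + s * x) * indicator {0..p} x = g (a + 1 * x) * indicator {a..<a + p} (a + 1 * x)"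
      using AE_lborel_singleton[of p] by eventually_elim (auto simp: s split: split_indicator)
  qed
  also have "\<dots> = (\<integral>\<^sup>+x. g x * indicator {a..<a + p} x \<partial>lborel)"
    by (subst nn_integral_real_affine[where c=1 and t=a and f="\<lambda>x. g x * indicator {a..<a + p} x"]) auto
  also have "\<dots> = (\<integral>\<^sup>+x. g x * indicator {0..<p} x \<partial>lborel)"
    by (rule nn_integral_periodic_shift[OF g per a])
  finally show ?thesis .
next
  assume s: "s = - 1"
  have "(\<integral>\<^sup>+x. g (a + s * x) * indicator {0..p} x \<partial>lborel) =
     (\<integral>\<^sup>+x. g (a + p + (- 1) * x) * indicator {a..<a + p} (a + p + (- 1) * x) \<partial>lborel)"
  proof (rule nn_integral_cong_AE)
    show "AE x in lborel. g (a + s * x) * indicator {0..p} x =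
        g (a + p + (- 1) * x) * indicator {a..<a + p} (a + p + (- 1) * x)"
      using AE_lborel_singleton[of 0]
    proof eventually_elim
      case (elim x)
      have "g (a + p - x) = g (a - x)" using per[of "a - x"] by (simp add: algebra_simps)
      then show ?case using elim by (auto simp: s split: split_indicator)
    qed
  qed
  also have "\<dots> = (\<integral>\<^sup>+x. g x * indicator {a..<a + p} x \<partial>lborel)"
    by (subst nn_integral_real_affine[where c="-1" and t="a + p" and f="\<lambda>x. g x * indicator {a..<a + p} x"]) auto
  also have "\<dots> = (\<integral>\<^sup>+x. g x * indicator {0..<p} x \<partial>lborel)"
    by (rule nn_integral_periodic_shift[OF g per a])
  finally show ?thesis .
qed

text \<open>An invertible linear map followed by radial projection maps the circle to itself; this is its lift to
  angles, \<open>\<phi> \<mapsto> \<alpha> + s * \<psi> \<phi>\<close>, where \<open>s\<close> is the sign of the determinant. The angular speed is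
  \<open>w \<phi> = \<bar>det B\<bar> / \<parallel>B (circ \<phi>)\<parallel>\<^sup>2\<close>, so \<open>\<psi>\<close> is defined as a primitive of \<open>w\<close>. It covers an angle of
  exactly \<open>2 * pi\<close>, because the map of the circle is injective.\<close>

lemma angular_lift:
  fixes B :: "real^2^2"
  assumes det: "det B \<noteq> 0" and w_def: "\<And>\<phi>. w \<phi> = \<bar>det B\<bar> / (norm (B *v circ \<phi>))\<^sup>2"
  obtains \<alpha> \<psi> s where "0 \<le> \<alpha>" "\<alpha> < 2 * pi" "s = 1 \<or> s = - 1" "\<psi> 0 = 0" "\<psi> (2 * pi) = 2 * pi"
    and "\<And>\<phi>. \<phi> \<in> {0..2 * pi} \<Longrightarrow> (\<psi> has_real_derivative w \<phi>) (at \<phi>)"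
    and "continuous_on {0..2 * pi} w"
    and "\<And>\<phi>. \<phi> \<in> {0..2 * pi} \<Longrightarrow> sgn (B *v circ \<phi>) = circ (\<alpha> + s * \<psi> \<phi>)"
proof -
  define x y where "x = (\<lambda>\<phi>. B$1$1 * cos \<phi> + B$1$2 * sin \<phi>)" and "y = (\<lambda>\<phi>. B$2$1 * cos \<phi> + B$2$2 * sin \<phi>)"
  define x' y' where "x' = (\<lambda>\<phi>. B$1$2 * cos \<phi> - B$1$1 * sin \<phi>)" and "y' = (\<lambda>\<phi>. B$2$2 * cos \<phi> - B$2$1 * sin \<phi>)"
  define r where "r = (\<lambda>\<phi>. norm (B *v circ \<phi>))"
  define s where "s = sgn (det B)"
  have s: "s = 1 \<or> s = - 1" "s * \<bar>det B\<bar> = det B" using det by (auto simp: s_def sgn_if)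
  have Bx: "(B *v circ \<phi>) $ 1 = x \<phi>" and By: "(B *v circ \<phi>) $ 2 = y \<phi>" for \<phi>
    by (simp_all add: matrix_vector_mult_def UNIV_2 x_def y_def)
  note B0 = matrix_vector_mult_eq_0D[OF det]
  have "circ \<phi> \<noteq> 0" for \<phi> using norm_circ[of \<phi>] by force
  then have r: "0 < r \<phi>" for \<phi> using B0[of "circ \<phi>"] by (auto simp: r_def)
  have r2: "(r \<phi>)\<^sup>2 = (x \<phi>)\<^sup>2 + (y \<phi>)\<^sup>2" for \<phi>
    by (simp add: r_def norm_vec2 Bx By)
  have rs: "r = (\<lambda>\<phi>. sqrt ((x \<phi>)\<^sup>2 + (y \<phi>)\<^sup>2))"
    by (simp add: r_def norm_vec2 Bx By)
  have w: "w \<phi> = \<bar>det B\<bar> / (r \<phi>)\<^sup>2" for \<phi> by (simp add: w_def r_def)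
  have w0: "0 < w \<phi>" for \<phi> using r[of \<phi>] det by (simp add: w)
  have dx: "(x has_real_derivative x' \<phi>) (at \<phi>)" and dy: "(y has_real_derivative y' \<phi>) (at \<phi>)" for \<phi>
    unfolding x_def y_def x'_def y'_def by (auto intro!: derivative_eq_intros)
  have xy': "x \<phi> * y' \<phi> - y \<phi> * x' \<phi> = det B" for \<phi>
  proof -
    have "x \<phi> * y' \<phi> - y \<phi> * x' \<phi> = det B * ((cos \<phi>)\<^sup>2 + (sin \<phi>)\<^sup>2)"
      unfolding x_def y_def x'_def y'_def det_2 by algebra
    then show ?thesis by simp
  qed
  have dr: "(r has_real_derivative (x \<phi> * x' \<phi> + y \<phi> * y' \<phi>) / r \<phi>) (at \<phi>)" for \<phi>
  proof -
    have "0 < (x \<phi>)\<^sup>2 + (y \<phi>)\<^sup>2" using r[of \<phi>] r2[of \<phi>] by (metis zero_less_power)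
    from DERIV_real_sqrt[OF this] have "((\<lambda>\<phi>. sqrt ((x \<phi>)\<^sup>2 + (y \<phi>)\<^sup>2)) has_real_derivative
        inverse (r \<phi>) / 2 * (2 * x \<phi> * x' \<phi> + 2 * y \<phi> * y' \<phi>)) (at \<phi>)"
      by (intro DERIV_chain2[where f=sqrt]) (auto intro!: derivative_eq_intros dx dy simp: rs)
    moreover have "inverse (r \<phi>) / 2 * (2 * x \<phi> * x' \<phi> + 2 * y \<phi> * y' \<phi>) = (x \<phi> * x' \<phi> + y \<phi> * y' \<phi>) / r \<phi>"
      using r[of \<phi>] by (simp add: field_simps)
    ultimately show ?thesis by (simp only: rs)
  qed
  have cr: "continuous_on UNIV r"
    using dr by (auto intro!: continuous_at_imp_continuous_on DERIV_isCont)
  have cw: "continuous_on A w" for A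
    unfolding w[abs_def] using r by (intro continuous_intros continuous_on_subset[OF cr]) (auto simp: less_imp_neq[symmetric])
  \<comment> \<open>The base point \<open>-1\<close> makes \<open>\<psi>\<close> differentiable on both sides of \<open>0\<close>.\<close>
  define \<psi> where "\<psi> \<phi> = integral {-1..\<phi>} w - integral {-1..0} w" for \<phi>
  have d\<psi>: "(\<psi> has_real_derivative w \<phi>) (at \<phi>)" if "\<phi> \<in> {0..2 * pi}" for \<phi>
  proof -
    have "((\<lambda>u. integral {-1..u} w) has_real_derivative w \<phi>) (at \<phi> within {-1..2 * pi + 1})"
      by (rule integral_has_real_derivative[OF cw]) (use that in auto)
    moreover have "at \<phi> within {-1..2 * pi + 1} = at \<phi>"
      using that by (intro at_within_Icc_at) auto
    ultimately have "((\<lambda>u. integral {-1..u} w) has_real_derivative w \<phi>) (at \<phi>)"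
      by (simp only:)
    then show ?thesis unfolding \<psi>_def[abs_def] by (auto intro!: derivative_eq_intros)
  qed
  have \<psi>0: "\<psi> 0 = 0" by (simp add: \<psi>_def)
  define X Y where "X = (\<lambda>\<phi>. x \<phi> / r \<phi>)" and "Y = (\<lambda>\<phi>. y \<phi> / r \<phi>)"
  have r2w: "s * w \<phi> * (r \<phi>)\<^sup>2 = det B" for \<phi>
    using r[of \<phi>] s(2) by (simp add: w)
  have dX: "(X has_real_derivative - Y \<phi> * (s * w \<phi>)) (at \<phi>)" for \<phi>
  proof -
    have "x' \<phi> * r \<phi> - x \<phi> * ((x \<phi> * x' \<phi> + y \<phi> * y' \<phi>) / r \<phi>) = 
          (x' \<phi> * (r \<phi>)\<^sup>2 - x \<phi> * (x \<phi> * x' \<phi> + y \<phi> * y' \<phi>)) / r \<phi>"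
      using r[of \<phi>] by (simp add: field_simps power2_eq_square)
    also have "x' \<phi> * (r \<phi>)\<^sup>2 - x \<phi> * (x \<phi> * x' \<phi> + y \<phi> * y' \<phi>) = - y \<phi> * (x \<phi> * y' \<phi> - y \<phi> * x' \<phi>)"
      unfolding r2 by algebra
    also have "\<dots> = - y \<phi> * (s * w \<phi> * (r \<phi>)\<^sup>2)" by (simp only: xy' r2w)
    finally have num: "x' \<phi> * r \<phi> - x \<phi> * ((x \<phi> * x' \<phi> + y \<phi> * y' \<phi>) / r \<phi>) =
        - y \<phi> * (s * w \<phi> * (r \<phi>)\<^sup>2) / r \<phi>" .
    have "(x' \<phi> * r \<phi> - x \<phi> * ((x \<phi> * x' \<phi> + y \<phi> * y' \<phi>) / r \<phi>)) / (r \<phi> * r \<phi>) = - Y \<phi> * (s * w \<phi>)"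
      unfolding num using r[of \<phi>] by (simp add: Y_def field_simps power2_eq_square)
    then show ?thesis
      unfolding X_def using DERIV_divide[OF dx dr, of \<phi>] r[of \<phi>] by (simp add: less_imp_neq[symmetric])
  qed
  have dY: "(Y has_real_derivative X \<phi> * (s * w \<phi>)) (at \<phi>)" for \<phi>
  proof -
    have "y' \<phi> * r \<phi> - y \<phi> * ((x \<phi> * x' \<phi> + y \<phi> * y' \<phi>) / r \<phi>) = 
          (y' \<phi> * (r \<phi>)\<^sup>2 - y \<phi> * (x \<phi> * x' \<phi> + y \<phi> * y' \<phi>)) / r \<phi>"
      using r[of \<phi>] by (simp add: field_simps power2_eq_square)
    also have "y' \<phi> * (r \<phi>)\<^sup>2 - y \<phi> * (x \<phi> * x' \<phi> + y \<phi> * y' \<phi>) = x \<phi> * (x \<phi> * y' \<phi> - y \<phi> * x' \<phi>)"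
      unfolding r2 by algebra
    also have "\<dots> = x \<phi> * (s * w \<phi> * (r \<phi>)\<^sup>2)" by (simp only: xy' r2w)
    finally have num: "y' \<phi> * r \<phi> - y \<phi> * ((x \<phi> * x' \<phi> + y \<phi> * y' \<phi>) / r \<phi>) =
        x \<phi> * (s * w \<phi> * (r \<phi>)\<^sup>2) / r \<phi>" .
    have "(y' \<phi> * r \<phi> - y \<phi> * ((x \<phi> * x' \<phi> + y \<phi> * y' \<phi>) / r \<phi>)) / (r \<phi> * r \<phi>) = X \<phi> * (s * w \<phi>)"
      unfolding num using r[of \<phi>] by (simp add: X_def field_simps power2_eq_square)
    then show ?thesis
      unfolding Y_def using DERIV_divide[OF dy dr, of \<phi>] r[of \<phi>] by (simp add: less_imp_neq[symmetric])
  qed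
  \<comment> \<open>\<open>(P, Q)\<close> is the unit vector \<open>(X, Y)\<close> turned back by the angle \<open>s * \<psi> \<phi>\<close>, hence constant.\<close>
  define P Q where "P = (\<lambda>\<phi>. X \<phi> * cos (s * \<psi> \<phi>) + Y \<phi> * sin (s * \<psi> \<phi>))"
    and "Q = (\<lambda>\<phi>. Y \<phi> * cos (s * \<psi> \<phi>) - X \<phi> * sin (s * \<psi> \<phi>))"
  have PQ: "P \<phi> = P 0" "Q \<phi> = Q 0" if \<phi>: "\<phi> \<in> {0..2 * pi}" for \<phi>
  proof -
    have "(P has_real_derivative 0) (at t)" "(Q has_real_derivative 0) (at t)" if "t \<in> {0..2 * pi}" for t
      unfolding P_def Q_def by (auto intro!: derivative_eq_intros dX dY d\<psi>[OF that] simp: algebra_simps)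
    moreover have "\<exists>c. \<forall>t\<in>{0..2 * pi}. f t = c"
      if "\<And>t. t \<in> {0..2 * pi} \<Longrightarrow> (f has_real_derivative 0) (at t)" for f
      by (rule has_field_derivative_zero_constant[OF convex_real_interval(5)])
         (rule has_field_derivative_at_within[OF that])
    ultimately have "\<exists>c. \<forall>t\<in>{0..2 * pi}. P t = c" "\<exists>c. \<forall>t\<in>{0..2 * pi}. Q t = c"
      by blast+
    moreover have "(0::real) \<in> {0..2 * pi}" by simp
    ultimately show "P \<phi> = P 0" "Q \<phi> = Q 0" using \<phi> by metis+
  qed
  have XY1: "(X \<phi>)\<^sup>2 + (Y \<phi>)\<^sup>2 = 1" for \<phi>
    using r[of \<phi>] by (simp add: X_def Y_def power_divide add_divide_distrib[symmetric] r2[symmetric])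
  obtain \<alpha> where \<alpha>: "0 \<le> \<alpha>" "\<alpha> < 2 * pi" "X 0 = cos \<alpha>" "Y 0 = sin \<alpha>"
    using sincos_total_2pi[OF XY1[of 0]] by metis
  have lift: "sgn (B *v circ \<phi>) = circ (\<alpha> + s * \<psi> \<phi>)" if \<phi>: "\<phi> \<in> {0..2 * pi}" for \<phi>
  proof -
    have P: "X \<phi> * cos (s * \<psi> \<phi>) + Y \<phi> * sin (s * \<psi> \<phi>) = cos \<alpha>"
      and Q: "Y \<phi> * cos (s * \<psi> \<phi>) - X \<phi> * sin (s * \<psi> \<phi>) = sin \<alpha>"
      using PQ[OF \<phi>] \<alpha> \<psi>0 by (auto simp: P_def Q_def)
    have cs: "(cos (s * \<psi> \<phi>))\<^sup>2 + (sin (s * \<psi> \<phi>))\<^sup>2 = 1" by simp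
    have "X \<phi> = cos (\<alpha> + s * \<psi> \<phi>)" "Y \<phi> = sin (\<alpha> + s * \<psi> \<phi>)"
      unfolding cos_add sin_add P[symmetric] Q[symmetric] using cs by algebra+
    then show ?thesis
      by (simp add: vec_eq_iff forall_2 sgn_div_norm Bx By X_def Y_def r_def divide_inverse_commute)
  qed
  have c\<psi>: "continuous_on {0..2 * pi} \<psi>"
    using d\<psi> by (intro DERIV_continuous_on) (auto intro: has_field_derivative_at_within)
  have "\<psi> 0 < \<psi> (2 * pi)"
    by (rule DERIV_pos_imp_increasing) (use d\<psi> w0 in force)+
  then have L0: "0 < \<psi> (2 * pi)" using \<psi>0 by simp
  have "circ (\<alpha> + s * \<psi> (2 * pi)) = circ (\<alpha> + s * \<psi> 0)"
    using lift[of 0] lift[of "2 * pi"] circ_periodic[of 0] by simp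
  then have "cos (\<alpha> + s * \<psi> (2 * pi)) = cos \<alpha> \<and> sin (\<alpha> + s * \<psi> (2 * pi)) = sin \<alpha>"
    using \<psi>0 by (simp add: vec_eq_iff forall_2)
  then obtain n :: int where n: "\<alpha> + s * \<psi> (2 * pi) = \<alpha> + 2 * pi * n"
    using sin_cos_eq_iff[of "\<alpha> + s * \<psi> (2 * pi)" \<alpha>] by auto
  \<comment> \<open>The lift gains a positive multiple of \<open>2 * pi\<close>; a larger one than \<open>2 * pi\<close> would contradict injectivity.\<close>
  have L1: "2 * pi \<le> \<psi> (2 * pi)"
  proof -
    obtain m :: int where m: "\<psi> (2 * pi) = 2 * pi * m"
      using n s(1) by (auto intro: that[of n] that[of "- n"])
    then have "0 < m" using L0 by (simp add: zero_less_mult_iff)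
    then have "1 \<le> real_of_int m" by simp
    then show ?thesis using m by simp
  qed
  moreover have "\<psi> (2 * pi) \<le> 2 * pi"
  proof (rule ccontr)
    assume *: "\<not> \<psi> (2 * pi) \<le> 2 * pi"
    obtain t where t: "0 \<le> t" "t \<le> 2 * pi" "\<psi> t = 2 * pi"
      using IVT'[of \<psi> 0 "2 * pi" "2 * pi"] \<psi>0 * c\<psi> by auto
    have t2: "t \<noteq> 0" "t \<noteq> 2 * pi" using t * \<psi>0 by auto
    have "circ (\<alpha> + s * \<psi> t) = circ \<alpha>"
      using s(1) circ_periodic[of \<alpha>] circ_periodic[of "\<alpha> - 2 * pi"] by (auto simp: t)
    then have "sgn (B *v circ t) = sgn (B *v circ 0)"
      using lift[of t] lift[of 0] t \<psi>0 by simp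
    then have sg: "inverse (r t) *\<^sub>R (B *v circ t) = inverse (r 0) *\<^sub>R (B *v circ 0)"
      by (simp only: sgn_div_norm r_def)
    have "B *v circ t = r t *\<^sub>R (inverse (r t) *\<^sub>R (B *v circ t))"
      using r[of t] by simp
    also have "\<dots> = (r t / r 0) *\<^sub>R (B *v circ 0)"
      unfolding sg by (simp add: divide_inverse)
    finally have "B *v (circ t - (r t / r 0) *\<^sub>R circ 0) = 0"
      by (simp add: matrix_vector_mult_diff_distrib matrix_vector_mult_scaleR)
    from B0[OF this] have "circ t = (r t / r 0) *\<^sub>R circ 0" by simp
    then have "circ t $ 1 = ((r t / r 0) *\<^sub>R circ 0) $ 1" "circ t $ 2 = ((r t / r 0) *\<^sub>R circ 0) $ 2"
      by simp_all
    then have ct: "cos t = r t / r 0" "sin t = 0" by simp_all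
    have "0 < r t / r 0" using r by simp
    then have "0 < cos t" by (simp only: ct)
    moreover have "(cos t)\<^sup>2 = 1" using sin_cos_squared_add[of t] by (simp only: ct(2)) simp
    ultimately have "cos t = 1" unfolding power2_eq_1_iff by linarith
    then obtain k :: int where k: "t = real_of_int k * 2 * pi" using cos_one_2pi_int by blast
    have "0 < t" using t(1) t2(1) by simp
    then have "0 < real_of_int k * (2 * pi)" by (simp only: k mult.assoc)
    from zero_less_mult_pos2[OF this] have "0 < k" by simp
    then have "2 * pi * 1 \<le> 2 * pi * k" by (intro mult_left_mono) auto
    then have "2 * pi \<le> t" by (simp add: k mult.commute)
    then show False using t(2) t2(2) by simp
  qed
  ultimately have "\<psi> (2 * pi) = 2 * pi" by simp
  then show ?thesis
    by (intro that[OF \<alpha>(1,2) s(1) \<psi>0 _ d\<psi> cw lift])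
qed

lemma measurable_sgn_linear:
  fixes B :: "real^2^2"
  assumes det: "det B \<noteq> 0"
  shows "(\<lambda>\<theta>. sgn (B *v \<theta>)) \<in> unif_S1 \<rightarrow>\<^sub>M unif_S1"
proof -
  note [measurable] = borel_measurable_matrix_vector_mult[of B]
  have "(\<lambda>\<theta>. sgn (B *v \<theta>)) \<in> borel \<rightarrow>\<^sub>M borel"
    unfolding sgn_div_norm by measurable
  moreover have "B *v \<theta> \<noteq> 0" if "norm \<theta> = 1" for \<theta>
    using matrix_vector_mult_eq_0D[OF det, of \<theta>] that by force
  ultimately have "(\<lambda>\<theta>. sgn (B *v \<theta>)) \<in> restrict_space borel S1 \<rightarrow>\<^sub>M restrict_space borel S1"
    by (intro measurable_restrict_space2 measurable_restrict_space1)
       (auto simp: norm_sgn space_restrict_space)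
  then show ?thesis by (simp add: measurable_cong_sets[OF sets_unif_S1 sets_unif_S1])
qed

text \<open>Change of variables on the circle for \<open>\<theta> \<mapsto> sgn (B *v \<theta>)\<close>: substitution along the angular lift.\<close>

lemma nn_integral_unif_S1_linear:
  fixes B :: "real^2^2"
  assumes det: "det B \<noteq> 0" and f[measurable]: "f \<in> borel_measurable unif_S1"
  shows "(\<integral>\<^sup>+\<theta>. ennreal (\<bar>det B\<bar> / (norm (B *v \<theta>))\<^sup>2) * f (sgn (B *v \<theta>)) \<partial>unif_S1) = (\<integral>\<^sup>+\<theta>. f \<theta> \<partial>unif_S1)"
proof -
  define w where "w \<phi> = \<bar>det B\<bar> / (norm (B *v circ \<phi>))\<^sup>2" for \<phi>
  obtain \<alpha> \<psi> s where \<alpha>: "0 \<le> \<alpha>" "\<alpha> < 2 * pi" and s: "s = 1 \<or> s = - 1"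
    and \<psi>: "\<psi> 0 = 0" "\<psi> (2 * pi) = 2 * pi"
    and d: "\<And>\<phi>. \<phi> \<in> {0..2 * pi} \<Longrightarrow> (\<psi> has_real_derivative w \<phi>) (at \<phi>)"
    and cw: "continuous_on {0..2 * pi} w"
    and lift: "\<And>\<phi>. \<phi> \<in> {0..2 * pi} \<Longrightarrow> sgn (B *v circ \<phi>) = circ (\<alpha> + s * \<psi> \<phi>)"
    by (rule angular_lift[OF det w_def]) (rule that)
  have F[measurable]: "(\<lambda>\<phi>. f (circ \<phi>)) \<in> borel_measurable borel"
    using measurable_circ f by (simp add: measurable_cong_sets[OF sets_unif_S1 refl])
  note h[measurable] = measurable_sgn_linear[OF det]
  note [measurable] = borel_measurable_unif_S1I[OF borel_measurable_matrix_vector_mult[of B]]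
  have "(\<integral>\<^sup>+\<theta>. ennreal (\<bar>det B\<bar> / (norm (B *v \<theta>))\<^sup>2) * f (sgn (B *v \<theta>)) \<partial>unif_S1) =
     ennreal (1 / (2 * pi)) * (\<integral>\<^sup>+\<phi>. ennreal (w \<phi>) * f (sgn (B *v circ \<phi>)) * indicator {0..<2 * pi} \<phi> \<partial>lborel)"
    unfolding w_def by (rule nn_integral_unif_S1) measurable
  also have "(\<integral>\<^sup>+\<phi>. ennreal (w \<phi>) * f (sgn (B *v circ \<phi>)) * indicator {0..<2 * pi} \<phi> \<partial>lborel) =
     (\<integral>\<^sup>+\<phi>. f (circ (\<alpha> + s * \<psi> \<phi>)) * ennreal (w \<phi>) * indicator {0..2 * pi} \<phi> \<partial>lborel)"
  proof (rule nn_integral_cong_AE)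
    show "AE \<phi> in lborel. ennreal (w \<phi>) * f (sgn (B *v circ \<phi>)) * indicator {0..<2 * pi} \<phi> =
       f (circ (\<alpha> + s * \<psi> \<phi>)) * ennreal (w \<phi>) * indicator {0..2 * pi} \<phi>"
      using AE_lborel_singleton[of "2 * pi"]
      by eventually_elim (auto simp: lift mult.commute split: split_indicator)
  qed
  also have "\<dots> = (\<integral>\<^sup>+x. f (circ (\<alpha> + s * x)) * indicator {0..2 * pi} x \<partial>lborel)"
    using nn_integral_substitution_aux[of "\<lambda>x. f (circ (\<alpha> + s * x))" 0 "2 * pi" \<psi> w] d cw \<psi>
    by (simp add: w_def)
  also have "\<dots> = (\<integral>\<^sup>+x. f (circ x) * indicator {0..<2 * pi} x \<partial>lborel)"
    by (rule nn_integral_periodic_isometry) (use \<alpha> s in \<open>auto simp: circ_periodic\<close>)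
  finally show ?thesis by (simp add: nn_integral_unif_S1)
qed

lemma integral_unif_S1_linear:
  fixes B :: "real^2^2" and f :: "real^2 \<Rightarrow> real"
  assumes det: "det B \<noteq> 0" and f[measurable]: "f \<in> borel_measurable unif_S1"
  shows "(\<integral>\<theta>. f \<theta> \<partial>unif_S1) = (\<integral>\<theta>. \<bar>det B\<bar> / (norm (B *v \<theta>))\<^sup>2 * f (sgn (B *v \<theta>)) \<partial>unif_S1)"
proof -
  note h[measurable] = measurable_sgn_linear[OF det]
  note [measurable] = borel_measurable_unif_S1I[OF borel_measurable_matrix_vector_mult[of B]]
  let ?w = "\<lambda>\<theta>. \<bar>det B\<bar> / (norm (B *v \<theta>))\<^sup>2"
  have "distr (density unif_S1 ?w) unif_S1 (\<lambda>\<theta>. sgn (B *v \<theta>)) = unif_S1"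
  proof (rule measure_eqI)
    fix A assume "A \<in> sets (distr (density unif_S1 ?w) unif_S1 (\<lambda>\<theta>. sgn (B *v \<theta>)))"
    then have [measurable]: "A \<in> sets unif_S1" by simp
    have "emeasure (distr (density unif_S1 ?w) unif_S1 (\<lambda>\<theta>. sgn (B *v \<theta>))) A = 
       (\<integral>\<^sup>+\<theta>. indicator A \<theta> \<partial>distr (density unif_S1 ?w) unif_S1 (\<lambda>\<theta>. sgn (B *v \<theta>)))" by simp
    also have "\<dots> = (\<integral>\<^sup>+\<theta>. indicator A (sgn (B *v \<theta>)) \<partial>density unif_S1 ?w)"
      by (rule nn_integral_distr) simp_all
    also have "\<dots> = (\<integral>\<^sup>+\<theta>. ennreal (?w \<theta>) * indicator A (sgn (B *v \<theta>)) \<partial>unif_S1)"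
      by (rule nn_integral_density) measurable
    also have "\<dots> = (\<integral>\<^sup>+\<theta>. indicator A \<theta> \<partial>unif_S1)"
      by (rule nn_integral_unif_S1_linear[OF det]) measurable
    finally show "emeasure (distr (density unif_S1 ?w) unif_S1 (\<lambda>\<theta>. sgn (B *v \<theta>))) A = emeasure unif_S1 A"
      by simp
  qed simp
  then have "(\<integral>\<theta>. f \<theta> \<partial>unif_S1) = (\<integral>\<theta>. f \<theta> \<partial>distr (density unif_S1 ?w) unif_S1 (\<lambda>\<theta>. sgn (B *v \<theta>)))" by simp
  also have "\<dots> = (\<integral>\<theta>. f (sgn (B *v \<theta>)) \<partial>density unif_S1 ?w)"
    by (rule integral_distr) simp_all
  also have "\<dots> = (\<integral>\<theta>. ?w \<theta> * f (sgn (B *v \<theta>)) \<partial>unif_S1)"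
    by (subst integral_density) auto
  finally show ?thesis .
qed

section \<open>Singular values of two-by-two matrices\<close>

lemma singular_values_char:
  fixes A :: "real^2^2"
  defines "T \<equiv> (A$1$1)\<^sup>2 + (A$1$2)\<^sup>2 + (A$2$1)\<^sup>2 + (A$2$2)\<^sup>2"
  shows "s \<in> singular_values A \<longleftrightarrow> 0 \<le> s \<and> (s\<^sup>2)\<^sup>2 - T * s\<^sup>2 + (det A)\<^sup>2 = 0"
proof -
  let ?G = "transpose A ** A"
  let ?N = "?G - mat (s\<^sup>2)"
  have "(transpose A ** A) *v v = s\<^sup>2 *\<^sub>R v \<longleftrightarrow> ?N *v v = 0" for v
  proof -
    have "mat (s\<^sup>2) *v v = s\<^sup>2 *\<^sub>R v"
      by (simp add: vec_eq_iff matrix_vector_mult_def mat_def if_distrib [of "\<lambda>x. x * y" for y] cong: if_cong)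
    then show ?thesis by (simp add: matrix_vector_mult_diff_rdistrib)
  qed
  then have "(\<exists>v. v \<noteq> 0 \<and> (transpose A ** A) *v v = s\<^sup>2 *\<^sub>R v) \<longleftrightarrow> (\<exists>v. v \<noteq> 0 \<and> ?N *v v = 0)" by simp
  also have "\<dots> \<longleftrightarrow> det ?N = 0"
    unfolding matrix_nonfull_linear_equations_eq det_eq_0_rank
    using rank_bound[of ?N] by auto
  also have "det ?N = (s\<^sup>2)\<^sup>2 - T * s\<^sup>2 + (det A)\<^sup>2"
    by (simp add: det_2 matrix_matrix_mult_def transpose_def mat_def UNIV_2 T_def)
       (simp add: power2_eq_square power4_eq_xxxx algebra_simps)
  finally show ?thesis by (simp add: singular_values_def)
qed

text \<open>The squares of the singular values are the two roots of the characteristic polynomial of the Gram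
  matrix, whose trace is \<open>T\<close> and whose determinant is \<open>(det A)\<^sup>2\<close>. The set of singular values is thus
  finite and nonempty, so its maximum and minimum are meaningful.\<close>

lemma singular_values_2x2:
  fixes A :: "real^2^2"
  defines "T \<equiv> (A$1$1)\<^sup>2 + (A$1$2)\<^sup>2 + (A$2$1)\<^sup>2 + (A$2$2)\<^sup>2"
  shows "(sigma_max A)\<^sup>2 + (sigma_min A)\<^sup>2 = T" and "sigma_max A * sigma_min A = \<bar>det A\<bar>"
    and "0 \<le> sigma_min A" and "sigma_min A \<le> sigma_max A"
proof -
  define d where "d = sqrt (T\<^sup>2 - 4 * (det A)\<^sup>2)"
  define l1 l2 where "l1 = (T + d) / 2" and "l2 = (T - d) / 2"
  have "T + 2 * det A = (A$1$1 + A$2$2)\<^sup>2 + (A$1$2 - A$2$1)\<^sup>2"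
    "T - 2 * det A = (A$1$1 - A$2$2)\<^sup>2 + (A$1$2 + A$2$1)\<^sup>2"
    by (auto simp: T_def det_2 power2_eq_square algebra_simps)
  then have "0 \<le> (T + 2 * det A) * (T - 2 * det A)" by simp
  also have "\<dots> = T\<^sup>2 - 4 * (det A)\<^sup>2" by (simp add: power2_eq_square algebra_simps)
  finally have d2: "d\<^sup>2 = T\<^sup>2 - 4 * (det A)\<^sup>2" and "0 \<le> d" by (auto simp: d_def)
  have "0 \<le> T" by (simp add: T_def)
  have "d \<le> T"
    by (rule power2_le_imp_le) (use d2 \<open>0 \<le> T\<close> in auto)
  have l: "0 \<le> l2" "l2 \<le> l1" "l1 + l2 = T"
    using \<open>0 \<le> d\<close> \<open>d \<le> T\<close> by (auto simp: l1_def l2_def field_simps)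
  have ll: "l1 * l2 = (det A)\<^sup>2"
    using d2 by (simp add: l1_def l2_def power2_eq_square field_simps)
  have "(s\<^sup>2)\<^sup>2 - T * s\<^sup>2 + (det A)\<^sup>2 = (s\<^sup>2 - l1) * (s\<^sup>2 - l2)" for s
    unfolding l(3)[symmetric] ll[symmetric] by (simp add: power2_eq_square algebra_simps)
  then have "s \<in> singular_values A \<longleftrightarrow> 0 \<le> s \<and> (s\<^sup>2 = l1 \<or> s\<^sup>2 = l2)" for s
    by (simp add: singular_values_char T_def)
  also have "\<dots> s \<longleftrightarrow> s \<in> {sqrt l1, sqrt l2}" for s
    using l by (auto simp: real_sqrt_unique)
  finally have "singular_values A = {sqrt l1, sqrt l2}" by blast
  then have "sigma_max A = sqrt l1" "sigma_min A = sqrt l2"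
    using l by (auto simp: sigma_max_def sigma_min_def max_def min_def)
  then show "(sigma_max A)\<^sup>2 + (sigma_min A)\<^sup>2 = T" "sigma_max A * sigma_min A = \<bar>det A\<bar>"
    "0 \<le> sigma_min A" "sigma_min A \<le> sigma_max A"
    using l ll by (auto simp: real_sqrt_mult[symmetric])
qed

lemma norm_transpose_mult_bounds:
  fixes A :: "real^2^2"
  assumes "norm \<theta> = 1"
  shows "(sigma_min A)\<^sup>2 \<le> (norm (transpose A *v \<theta>))\<^sup>2"
    and "(norm (transpose A *v \<theta>))\<^sup>2 \<le> (sigma_max A)\<^sup>2"
proof -
  \<comment> \<open>\<open>x\<close> and \<open>y\<close> are the squared lengths of the images of \<open>\<theta>\<close> and of \<open>\<theta>\<close> rotated by a right angle. Their sum
    is the trace, and their product is at least the squared determinant.\<close>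
  define x where "x = (A$1$1 * \<theta>$1 + A$2$1 * \<theta>$2)\<^sup>2 + (A$1$2 * \<theta>$1 + A$2$2 * \<theta>$2)\<^sup>2"
  define y where "y = (A$2$1 * \<theta>$1 - A$1$1 * \<theta>$2)\<^sup>2 + (A$2$2 * \<theta>$1 - A$1$2 * \<theta>$2)\<^sup>2"
  have x: "(norm (transpose A *v \<theta>))\<^sup>2 = x"
    by (simp add: x_def norm_eq_sqrt_inner inner_vec_def matrix_vector_mult_def transpose_def sum_2 UNIV_2 power2_eq_square)
  have th: "(\<theta>$1)\<^sup>2 + (\<theta>$2)\<^sup>2 = 1"
    using assms by (simp add: norm_eq_sqrt_inner inner_vec_def UNIV_2 power2_eq_square)
  have "x + y = ((A$1$1)\<^sup>2 + (A$1$2)\<^sup>2 + (A$2$1)\<^sup>2 + (A$2$2)\<^sup>2) * ((\<theta>$1)\<^sup>2 + (\<theta>$2)\<^sup>2)"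
    unfolding x_def y_def by algebra
  then have xy: "x + y = (sigma_max A)\<^sup>2 + (sigma_min A)\<^sup>2"
    by (simp add: th singular_values_2x2)
  have "x * y = (det A * ((\<theta>$1)\<^sup>2 + (\<theta>$2)\<^sup>2))\<^sup>2 +
    ((A$1$1 * \<theta>$1 + A$2$1 * \<theta>$2) * (A$2$1 * \<theta>$1 - A$1$1 * \<theta>$2) +
     (A$1$2 * \<theta>$1 + A$2$2 * \<theta>$2) * (A$2$2 * \<theta>$1 - A$1$2 * \<theta>$2))\<^sup>2"
    unfolding x_def y_def det_2 by algebra
  then have "(det A)\<^sup>2 \<le> x * y" by (simp add: th)
  moreover have "(det A)\<^sup>2 = (sigma_max A)\<^sup>2 * (sigma_min A)\<^sup>2"
    using singular_values_2x2(2)[of A] by (metis power2_abs power_mult_distrib)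
  moreover have "y = (sigma_max A)\<^sup>2 + (sigma_min A)\<^sup>2 - x" using xy by simp
  ultimately have p: "(x - (sigma_max A)\<^sup>2) * (x - (sigma_min A)\<^sup>2) \<le> 0"
    by (simp add: algebra_simps power2_eq_square)
  have o: "(sigma_min A)\<^sup>2 \<le> (sigma_max A)\<^sup>2"
    by (intro power_mono singular_values_2x2)
  show "(sigma_min A)\<^sup>2 \<le> (norm (transpose A *v \<theta>))\<^sup>2" "(norm (transpose A *v \<theta>))\<^sup>2 \<le> (sigma_max A)\<^sup>2"
    unfolding x using p o by (auto simp: mult_le_0_iff)
qed

lemma circle_jacobian_bound:
  fixes A :: "real^2^2"
  assumes A: "invertible A" and \<theta>: "norm \<theta> = 1"
  shows "\<bar>1 - \<bar>det A\<bar> / (norm (transpose A *v \<theta>))\<^sup>2\<bar> \<le> (sigma_max A - sigma_min A) / sigma_min A"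
proof -
  define S s n where "S = sigma_max A" and "s = sigma_min A" and "n = (norm (transpose A *v \<theta>))\<^sup>2"
  have d: "\<bar>det A\<bar> = S * s" and "0 \<le> s" "s \<le> S"
    using singular_values_2x2[of A] by (auto simp: S_def s_def)
  have "S * s \<noteq> 0" using A d by (auto simp: invertible_det_nz)
  then have "0 < s" "0 < S" using \<open>0 \<le> s\<close> \<open>s \<le> S\<close> by auto
  have n: "s\<^sup>2 \<le> n" "n \<le> S\<^sup>2"
    using norm_transpose_mult_bounds[OF \<theta>, of A] by (auto simp: S_def s_def n_def)
  have "0 < n" using n(1) \<open>0 < s\<close> by (smt (verit) zero_less_power)
  have "S * s / n \<le> S * s / s\<^sup>2"
    using n(1) \<open>0 < s\<close> \<open>0 < S\<close> \<open>0 < n\<close> by (intro divide_left_mono) auto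
  also have "\<dots> = S / s" using \<open>0 < s\<close> by (simp add: power2_eq_square)
  finally have up: "S * s / n \<le> S / s" .
  have "s / S = S * s / S\<^sup>2" using \<open>0 < S\<close> by (simp add: power2_eq_square)
  also have "\<dots> \<le> S * s / n"
    using n(2) \<open>0 < s\<close> \<open>0 < S\<close> \<open>0 < n\<close> by (intro divide_left_mono) auto
  finally have lo: "s / S \<le> S * s / n" .
  have "1 - s / S = (S - s) / S" using \<open>0 < S\<close> by (simp add: field_simps)
  also have "\<dots> \<le> (S - s) / s"
    using \<open>0 < s\<close> \<open>s \<le> S\<close> by (intro divide_left_mono) auto
  finally have "1 - s / S \<le> (S - s) / s" .
  moreover have "S / s - 1 = (S - s) / s" using \<open>0 < s\<close> by (simp add: field_simps)
  ultimately have "\<bar>1 - S * s / n\<bar> \<le> (S - s) / s" using up lo by linarith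
  then show ?thesis by (simp add: d S_def s_def n_def)
qed

section \<open>The R-CDT of plane measures\<close>

lemma P2_prob_space: "\<mu> \<in> P2 \<Longrightarrow> prob_space \<mu>"
  and P2_sets: "\<mu> \<in> P2 \<Longrightarrow> sets \<mu> = sets borel"
  and P2_space: "\<mu> \<in> P2 \<Longrightarrow> space \<mu> = UNIV"
  and P2_integrable: "\<mu> \<in> P2 \<Longrightarrow> integrable \<mu> (\<lambda>x. (norm x)\<^sup>2)"
  by (auto simp: P2_def borel_prob_def dest: sets_eq_imp_space_eq)

lemma measurable_inner_const:
  fixes \<mu> :: "(real^2) measure"
  assumes "sets \<mu> = sets borel"
  shows "(\<lambda>x. x \<bullet> \<theta>) \<in> borel_measurable \<mu>"
  unfolding measurable_cong_sets[OF assms refl] by simp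

lemma real_distribution_radon:
  assumes "prob_space \<mu>" "sets \<mu> = sets borel"
  shows "real_distribution (radon \<mu> \<theta>)"
  unfolding radon_def
  by (rule prob_space.real_distribution_distr[OF assms(1) measurable_inner_const[OF assms(2)]])

lemma product_coupling:
  assumes \<mu>: "\<mu> \<in> P2" and \<nu>: "\<nu> \<in> P2"
  shows "\<mu> \<Otimes>\<^sub>M \<nu> \<in> couplings \<mu> \<nu>"
proof -
  interpret \<mu>: prob_space \<mu> by (rule P2_prob_space[OF \<mu>])
  interpret \<nu>: prob_space \<nu> by (rule P2_prob_space[OF \<nu>])
  interpret \<mu>\<nu>: pair_prob_space \<mu> \<nu> ..
  have s: "sets (\<mu> \<Otimes>\<^sub>M \<nu>) = sets borel"
    using sets_pair_measure_cong[OF P2_sets[OF \<mu>] P2_sets[OF \<nu>]] by (simp only: borel_prod)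
  have 1: "distr (\<mu> \<Otimes>\<^sub>M \<nu>) borel fst = \<mu>"
  proof -
    have "distr (\<mu> \<Otimes>\<^sub>M \<nu>) borel fst = distr (\<mu> \<Otimes>\<^sub>M \<nu>) \<mu> fst"
      by (rule distr_cong) (simp_all add: P2_sets[OF \<mu>])
    also have "\<dots> = \<mu>" by (rule \<nu>.distr_pair_fst)
    finally show ?thesis .
  qed
  have 2: "distr (\<mu> \<Otimes>\<^sub>M \<nu>) borel snd = \<nu>"
  proof (rule measure_eqI)
    fix A assume "A \<in> sets (distr (\<mu> \<Otimes>\<^sub>M \<nu>) borel snd)"
    then have A: "A \<in> sets \<nu>" by (simp add: P2_sets[OF \<nu>])
    have "snd -` A \<inter> space (\<mu> \<Otimes>\<^sub>M \<nu>) = space \<mu> \<times> A"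
      using sets.sets_into_space[OF A] by (auto simp: space_pair_measure)
    moreover have "snd \<in> borel_measurable (\<mu> \<Otimes>\<^sub>M \<nu>)"
      using measurable_snd[of \<mu> \<nu>] measurable_cong_sets[OF refl P2_sets[OF \<nu>]] by blast
    ultimately show "emeasure (distr (\<mu> \<Otimes>\<^sub>M \<nu>) borel snd) A = emeasure \<nu> A"
      using A by (subst emeasure_distr) (auto simp: P2_sets[OF \<nu>] \<nu>.emeasure_pair_measure_Times \<mu>.emeasure_space_1)
  qed (simp add: P2_sets[OF \<nu>])
  show ?thesis
    unfolding couplings_def borel_prob_def using s 1 2 \<mu>\<nu>.prob_space_axioms by simp
qed

lemma coupling_cost_integrable:
  assumes \<mu>: "\<mu> \<in> P2" and \<nu>: "\<nu> \<in> P2" and \<pi>: "\<pi> \<in> couplings \<mu> \<nu>"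
  shows "integrable \<pi> (\<lambda>p. (norm (fst p - snd p))\<^sup>2)"
proof -
  have s: "sets \<pi> = sets borel" and m: "distr \<pi> borel fst = \<mu>" "distr \<pi> borel snd = \<nu>"
    using \<pi> by (auto simp: couplings_def borel_prob_def)
  have f: "fst \<in> \<pi> \<rightarrow>\<^sub>M borel" "snd \<in> \<pi> \<rightarrow>\<^sub>M borel"
    unfolding measurable_cong_sets[OF s refl] by (simp_all add: borel_prod[symmetric])
  note [measurable] = f
  have "integrable \<pi> (\<lambda>p. (norm (fst p))\<^sup>2)"
    using P2_integrable[OF \<mu>] unfolding m(1)[symmetric] by (subst (asm) integrable_distr_eq) auto
  moreover have "integrable \<pi> (\<lambda>p. (norm (snd p))\<^sup>2)"
    using P2_integrable[OF \<nu>] unfolding m(2)[symmetric] by (subst (asm) integrable_distr_eq) auto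
  ultimately have i: "integrable \<pi> (\<lambda>p. 2 * (norm (fst p))\<^sup>2 + 2 * (norm (snd p))\<^sup>2)" by simp
  have b: "(norm (a - b))\<^sup>2 \<le> 2 * (norm a)\<^sup>2 + 2 * (norm b)\<^sup>2" for a b :: "real^2"
  proof -
    have "(norm (a - b))\<^sup>2 \<le> (norm a + norm b)\<^sup>2"
      by (intro power_mono norm_triangle_ineq4) simp
    also have "\<dots> \<le> 2 * (norm a)\<^sup>2 + 2 * (norm b)\<^sup>2"
      using sum_squares_bound[of "norm a" "norm b"] by (simp add: power2_sum)
    finally show ?thesis .
  qed
  show ?thesis
    by (rule Bochner_Integration.integrable_bound[OF i]) (use b in auto)
qed

lemma L2_const: "prob_space M \<Longrightarrow> (\<lambda>_. k) \<in> L2 M"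
  by (simp add: L2_def prob_space.finite_measure finite_measure.integrable_const)

lemma L2_integrable: "prob_space M \<Longrightarrow> f \<in> L2 M \<Longrightarrow> integrable M f"
  using L2_integrable_mult[of f M "\<lambda>_. 1"] by (simp add: L2_const)

text \<open>Shifting and rescaling a function to mean \<open>0\<close> and standard deviation \<open>1\<close>; the zero function if the
  standard deviation vanishes.\<close>

definition standardize :: "real measure \<Rightarrow> (real \<Rightarrow> real) \<Rightarrow> real \<Rightarrow> real" where
  "standardize \<rho> g t = (g t - mean \<rho> g) / std \<rho> g"

lemma nrcdt_eq_standardize: "nrcdt \<rho> \<mu> (t, \<theta>) = standardize \<rho> (rcdt \<rho> \<mu> \<theta>) t"
  by (simp add: nrcdt_def standardize_def)

lemma std_eq_L2_norm: "std \<rho> g = L2_norm \<rho> (\<lambda>t. g t - mean \<rho> g)"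
  by (simp add: std_def L2_norm_def)

context
  fixes \<rho> :: "real measure"
  assumes prob: "prob_space \<rho>"
begin

lemma L2_centered: "f \<in> L2 \<rho> \<Longrightarrow> (\<lambda>t. f t - mean \<rho> f) \<in> L2 \<rho>"
  by (intro L2_diff L2_const prob)

lemma L2_norm_centered_diff_le:
  assumes f: "f \<in> L2 \<rho>" and g: "g \<in> L2 \<rho>"
  shows "L2_norm \<rho> (\<lambda>t. (f t - mean \<rho> f) - (g t - mean \<rho> g)) \<le> L2_norm \<rho> (\<lambda>t. f t - g t)"
proof -
  interpret prob_space \<rho> by (rule prob)
  let ?h = "\<lambda>t. f t - g t"
  have h: "?h \<in> L2 \<rho>" by (rule L2_diff[OF f g])
  have e: "expectation ?h = mean \<rho> f - mean \<rho> g"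
    using L2_integrable[OF prob f] L2_integrable[OF prob g] by (simp add: mean_def)
  have "(\<integral>t. ((f t - mean \<rho> f) - (g t - mean \<rho> g))\<^sup>2 \<partial>\<rho>) = variance ?h"
    unfolding e by (simp add: algebra_simps)
  also have "\<dots> \<le> (\<integral>t. (?h t)\<^sup>2 \<partial>\<rho>)"
    by (subst variance_eq[OF L2_integrable[OF prob h] L2_integrable_square[OF h]]) simp
  finally show ?thesis by (simp add: L2_norm_def)
qed

lemma std_diff_le:
  assumes f: "f \<in> L2 \<rho>" and g: "g \<in> L2 \<rho>"
  shows "\<bar>std \<rho> f - std \<rho> g\<bar> \<le> L2_norm \<rho> (\<lambda>t. f t - g t)"
proof -
  have *: "std \<rho> f \<le> std \<rho> g + L2_norm \<rho> (\<lambda>t. f t - g t)"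
    if f: "f \<in> L2 \<rho>" and g: "g \<in> L2 \<rho>" for f g
    using L2_norm_add_le[OF L2_diff[OF L2_centered[OF f] L2_centered[OF g]] L2_centered[OF g]]
      L2_norm_centered_diff_le[OF f g] by (simp add: std_eq_L2_norm)
  from *[OF f g] *[OF g f] show ?thesis
    by (simp add: L2_norm_minus_commute[of \<rho> g f] abs_le_iff)
qed

lemma L2_standardize: "f \<in> L2 \<rho> \<Longrightarrow> standardize \<rho> f \<in> L2 \<rho>"
  using L2_cmult[OF L2_centered[of f], of "inverse (std \<rho> f)"]
  by (simp add: standardize_def[abs_def] divide_inverse_commute)

lemma L2_norm_standardize:
  assumes "0 < std \<rho> f"
  shows "L2_norm \<rho> (standardize \<rho> f) = 1"
proof -
  have "standardize \<rho> f = (\<lambda>t. inverse (std \<rho> f) * (f t - mean \<rho> f))"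
    by (simp add: fun_eq_iff standardize_def divide_inverse_commute)
  then show ?thesis
    using assms by (simp add: L2_norm_cmult std_eq_L2_norm[symmetric])
qed

lemma L2_norm_standardize_diff_le:
  assumes f: "f \<in> L2 \<rho>" and g: "g \<in> L2 \<rho>" and pos: "0 < std \<rho> f" "0 < std \<rho> g"
  shows "L2_norm \<rho> (\<lambda>t. standardize \<rho> f t - standardize \<rho> g t) \<le> 2 * L2_norm \<rho> (\<lambda>t. f t - g t) / std \<rho> g"
proof -
  let ?f = "\<lambda>t. f t - mean \<rho> f" and ?g = "\<lambda>t. g t - mean \<rho> g" and ?d = "L2_norm \<rho> (\<lambda>t. f t - g t)"
  \<comment> \<open>\<open>f\<^sub>0/s\<^sub>f - g\<^sub>0/s\<^sub>g = (f\<^sub>0 - g\<^sub>0)/s\<^sub>g + k * (f\<^sub>0/s\<^sub>f)\<close> for the centred functions \<open>f\<^sub>0\<close>, \<open>g\<^sub>0\<close>, and \<open>f\<^sub>0/s\<^sub>f\<close> has norm \<open>1\<close>.\<close>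
  define k where "k = (std \<rho> g - std \<rho> f) / std \<rho> g"
  have "standardize \<rho> f t - standardize \<rho> g t = inverse (std \<rho> g) * (?f t - ?g t) + k * standardize \<rho> f t" for t
    using pos by (simp add: standardize_def k_def field_simps)
  then have "L2_norm \<rho> (\<lambda>t. standardize \<rho> f t - standardize \<rho> g t) \<le>
      L2_norm \<rho> (\<lambda>t. inverse (std \<rho> g) * (?f t - ?g t)) + L2_norm \<rho> (\<lambda>t. k * standardize \<rho> f t)"
    by (simp only:) (intro L2_norm_add_le L2_cmult L2_diff[OF L2_centered[OF f] L2_centered[OF g]] L2_standardize f)
  moreover have "L2_norm \<rho> (\<lambda>t. k * standardize \<rho> f t) \<le> ?d / std \<rho> g"
  proof -
    have "\<bar>std \<rho> g - std \<rho> f\<bar> \<le> ?d"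
      using std_diff_le[OF f g] by (simp add: abs_minus_commute)
    then have "\<bar>k\<bar> \<le> ?d / std \<rho> g"
      using pos by (simp add: k_def abs_divide divide_right_mono)
    moreover have "L2_norm \<rho> (\<lambda>t. k * standardize \<rho> f t) = \<bar>k\<bar> * L2_norm \<rho> (standardize \<rho> f)"
      by (rule L2_norm_cmult)
    ultimately show ?thesis by (simp add: L2_norm_standardize[OF pos(1)])
  qed
  moreover have "L2_norm \<rho> (\<lambda>t. inverse (std \<rho> g) * (?f t - ?g t)) \<le> ?d / std \<rho> g"
  proof -
    have "L2_norm \<rho> (\<lambda>t. inverse (std \<rho> g) * (?f t - ?g t)) = \<bar>inverse (std \<rho> g)\<bar> * L2_norm \<rho> (\<lambda>t. ?f t - ?g t)"
      by (rule L2_norm_cmult)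
    moreover have "\<bar>inverse (std \<rho> g)\<bar> * L2_norm \<rho> (\<lambda>t. ?f t - ?g t) \<le> \<bar>inverse (std \<rho> g)\<bar> * ?d"
      by (intro mult_left_mono L2_norm_centered_diff_le f g) simp
    moreover have "\<bar>inverse (std \<rho> g)\<bar> * ?d = ?d / std \<rho> g"
      using pos(2) by (simp add: divide_inverse)
    ultimately show ?thesis by linarith
  qed
  ultimately show ?thesis by simp
qed

text \<open>An increasing affine relation that holds almost everywhere determines mean and standard deviation,
  so the standardizations agree at each point where the relation holds.\<close>

lemma standardize_affine:
  assumes g: "g \<in> L2 \<rho>" and [measurable]: "f \<in> borel_measurable \<rho>"
    and a: "0 < a" and eq: "AE t in \<rho>. f t = a * g t + b"
  shows "f t = a * g t + b \<Longrightarrow> standardize \<rho> f t = standardize \<rho> g t"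
proof -
  interpret prob_space \<rho> by (rule prob)
  have [measurable]: "g \<in> borel_measurable \<rho>" by (rule L2_measurable[OF g])
  have "mean \<rho> f = (\<integral>t. a * g t + b \<partial>\<rho>)"
    unfolding mean_def using eq by (intro integral_cong_AE) auto
  then have m: "mean \<rho> f = a * mean \<rho> g + b"
    using L2_integrable[OF prob g] by (simp add: mean_def prob_space)
  have "std \<rho> f = L2_norm \<rho> (\<lambda>t. a * (g t - mean \<rho> g))"
    unfolding std_eq_L2_norm
  proof (rule L2_norm_cong_AE)
    show "AE t in \<rho>. f t - mean \<rho> f = a * (g t - mean \<rho> g)"
      using eq by eventually_elim (simp add: m algebra_simps)
  qed measurable
  then have s: "std \<rho> f = a * std \<rho> g"
    using a by (simp add: L2_norm_cmult std_eq_L2_norm[symmetric])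
  assume "f t = a * g t + b"
  then have "f t - mean \<rho> f = a * (g t - mean \<rho> g)" by (simp add: m algebra_simps)
  then show "standardize \<rho> f t = standardize \<rho> g t"
    using a by (simp add: standardize_def s)
qed

end

context atomless_distribution
begin

lemma L2_rcdt:
  assumes \<mu>: "\<mu> \<in> P2"
  shows "rcdt M \<mu> \<theta> \<in> L2 M"
proof -
  have r: "real_distribution (radon \<mu> \<theta>)"
    by (rule real_distribution_radon[OF P2_prob_space[OF \<mu>] P2_sets[OF \<mu>]])
  have m[measurable]: "rcdt M \<mu> \<theta> \<in> borel_measurable M"
    using measurable_cdt[OF r] by (simp add: rcdt_def)
  note [measurable] = measurable_inner_const[OF P2_sets[OF \<mu>], of \<theta>]
  have "integrable \<mu> (\<lambda>x. (norm \<theta>)\<^sup>2 * (norm x)\<^sup>2)"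
    using P2_integrable[OF \<mu>] by simp
  then have "integrable \<mu> (\<lambda>x. (x \<bullet> \<theta>)\<^sup>2)"
  proof (rule Bochner_Integration.integrable_bound)
    have "(x \<bullet> \<theta>)\<^sup>2 \<le> (norm \<theta>)\<^sup>2 * (norm x)\<^sup>2" for x
      using Cauchy_Schwarz_ineq[of x \<theta>] by (simp add: power2_norm_eq_inner mult.commute)
    then show "AE x in \<mu>. norm ((x \<bullet> \<theta>)\<^sup>2) \<le> norm ((norm \<theta>)\<^sup>2 * (norm x)\<^sup>2)" by simp
  qed measurable
  then have "integrable (radon \<mu> \<theta>) (\<lambda>y. y\<^sup>2)"
    unfolding radon_def by (subst integrable_distr_eq) auto
  then have "integrable (distr M borel (rcdt M \<mu> \<theta>)) (\<lambda>y. y\<^sup>2)"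
    using distr_cdt[OF r] by (simp add: rcdt_def)
  then have "integrable M (\<lambda>t. (rcdt M \<mu> \<theta> t)\<^sup>2)"
    by (subst (asm) integrable_distr_eq) auto
  then show ?thesis using m by (simp add: L2_def)
qed

lemma rcdt_dist_le_coupling_cost:
  assumes \<mu>: "\<mu> \<in> P2" and \<nu>: "\<nu> \<in> P2" and \<theta>: "norm \<theta> = 1" and \<pi>: "\<pi> \<in> couplings \<mu> \<nu>"
  shows "L2_norm M (\<lambda>t. rcdt M \<mu> \<theta> t - rcdt M \<nu> \<theta> t) \<le> sqrt (\<integral>p. (norm (fst p - snd p))\<^sup>2 \<partial>\<pi>)"
proof -
  have s: "sets \<pi> = sets borel" and m: "distr \<pi> borel fst = \<mu>" "distr \<pi> borel snd = \<nu>" and P: "prob_space \<pi>"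
    using \<pi> by (auto simp: couplings_def borel_prob_def)
  have [measurable]: "fst \<in> \<pi> \<rightarrow>\<^sub>M borel" "snd \<in> \<pi> \<rightarrow>\<^sub>M borel"
    unfolding measurable_cong_sets[OF s refl] by (simp_all add: borel_prod[symmetric])
  let ?X = "\<lambda>p. fst p \<bullet> \<theta>" and ?Y = "\<lambda>p. snd p \<bullet> \<theta>"
  have X[measurable]: "?X \<in> borel_measurable \<pi>" and Y[measurable]: "?Y \<in> borel_measurable \<pi>" by measurable
  have d: "radon \<mu> \<theta> = distr \<pi> borel ?X" "radon \<nu> \<theta> = distr \<pi> borel ?Y"
    unfolding radon_def m[symmetric] by (subst distr_distr; simp add: o_def)+
  have "(\<integral>\<^sup>+t. ennreal ((rcdt M \<mu> \<theta> t - rcdt M \<nu> \<theta> t)\<^sup>2) \<partial>M) \<le> (\<integral>\<^sup>+p. ennreal ((?X p - ?Y p)\<^sup>2) \<partial>\<pi>)"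
    unfolding rcdt_def d by (rule monotone_coupling_optimal[OF P X Y])
  also have "\<dots> \<le> (\<integral>\<^sup>+p. ennreal ((norm (fst p - snd p))\<^sup>2) \<partial>\<pi>)"
  proof (intro nn_integral_mono ennreal_leI)
    fix p :: "(real^2) \<times> (real^2)"
    have "\<bar>(fst p - snd p) \<bullet> \<theta>\<bar> \<le> norm (fst p - snd p)"
      using Cauchy_Schwarz_ineq2[of "fst p - snd p" \<theta>] by (simp add: \<theta>)
    then have "\<bar>(fst p - snd p) \<bullet> \<theta>\<bar>\<^sup>2 \<le> (norm (fst p - snd p))\<^sup>2" by (rule power_mono) simp
    then show "(?X p - ?Y p)\<^sup>2 \<le> (norm (fst p - snd p))\<^sup>2" by (simp add: inner_diff_left)
  qed
  also have "\<dots> = ennreal (\<integral>p. (norm (fst p - snd p))\<^sup>2 \<partial>\<pi>)"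
    by (rule nn_integral_eq_integral[OF coupling_cost_integrable[OF \<mu> \<nu> \<pi>]]) simp
  finally show ?thesis
    using L2_measurable[OF L2_diff[OF L2_rcdt[OF \<mu>, of \<theta>] L2_rcdt[OF \<nu>, of \<theta>]]]
    by (intro L2I_nn_integral(2)) simp_all
qed

text \<open>The bound for all couplings passes to the infimum because the set of couplings contains the product
  measure and is thus nonempty.\<close>

lemma rcdt_dist_le_W2:
  assumes \<mu>: "\<mu> \<in> P2" and \<nu>: "\<nu> \<in> P2" and \<theta>: "norm \<theta> = 1"
  shows "L2_norm M (\<lambda>t. rcdt M \<mu> \<theta> t - rcdt M \<nu> \<theta> t) \<le> W2 \<mu> \<nu>"
  unfolding W2_def
  by (rule cINF_greatest) (use product_coupling[OF \<mu> \<nu>] rcdt_dist_le_coupling_cost[OF \<mu> \<nu> \<theta>] in auto)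

lemma measurable_rcdt_pair:
  assumes \<mu>: "prob_space \<mu>" "sets \<mu> = sets borel"
  shows "(\<lambda>(t, \<theta>). rcdt M \<mu> \<theta> t) \<in> borel_measurable (M \<Otimes>\<^sub>M unif_S1)"
proof -
  interpret \<mu>: prob_space \<mu> by fact
  have space: "space \<mu> = UNIV" using sets_eq_imp_space_eq[OF \<mu>(2)] by simp
  have id1: "(\<lambda>\<theta>. \<theta>) \<in> borel_measurable unif_S1"
    unfolding measurable_cong_sets[OF sets_unif_S1 refl] by (rule measurable_restrict_space1) simp
  have id2: "(\<lambda>x. x) \<in> borel_measurable \<mu>"
    unfolding measurable_cong_sets[OF \<mu>(2) refl] by simp
  have cdf: "(\<lambda>\<theta>. cdf (radon \<mu> \<theta>) s) \<in> borel_measurable unif_S1" for s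
  proof -
    have "(\<lambda>p. snd p \<bullet> fst p) \<in> borel_measurable (unif_S1 \<Otimes>\<^sub>M \<mu>)"
      using measurable_compose[OF measurable_fst id1, of \<mu>] measurable_compose[OF measurable_snd id2, of unif_S1]
      by (intro borel_measurable_inner) simp_all
    then have Q: "{p \<in> space (unif_S1 \<Otimes>\<^sub>M \<mu>). snd p \<bullet> fst p \<le> s} \<in> sets (unif_S1 \<Otimes>\<^sub>M \<mu>)"
      by (rule borel_measurable_le) simp
    have "cdf (radon \<mu> \<theta>) s = measure \<mu> (Pair \<theta> -` {p \<in> space (unif_S1 \<Otimes>\<^sub>M \<mu>). snd p \<bullet> fst p \<le> s})"
      if "\<theta> \<in> space unif_S1" for \<theta>
      unfolding cdf_def radon_def using that measurable_inner_const[OF \<mu>(2)]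
      by (subst measure_distr) (auto simp: space_pair_measure space intro!: arg_cong[where f="measure \<mu>"])
    then show ?thesis
      using \<mu>.measurable_emeasure_Pair[OF Q]
      by (subst measurable_cong[where g="\<lambda>\<theta>. measure \<mu> (Pair \<theta> -` {p \<in> space (unif_S1 \<Otimes>\<^sub>M \<mu>). snd p \<bullet> fst p \<le> s})"])
         (simp_all add: measure_def)
  qed
  have "(\<lambda>p. quantile (radon \<mu> (snd p)) (cdf M (fst p))) \<in> borel_measurable (M \<Otimes>\<^sub>M unif_S1)"
  proof (rule borel_measurable_quantile)
    show "(\<lambda>p. cdf (radon \<mu> (snd p)) s) \<in> borel_measurable (M \<Otimes>\<^sub>M unif_S1)" for s
      by (rule measurable_compose[OF measurable_snd cdf])
    show "(\<lambda>p. cdf M (fst p)) \<in> borel_measurable (M \<Otimes>\<^sub>M unif_S1)"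
      by measurable
    show "cdf (radon \<mu> (snd p)) s \<le> cdf (radon \<mu> (snd p)) s'" if "s \<le> s'" for p s s'
    proof -
      interpret r: real_distribution "radon \<mu> (snd p)" by (rule real_distribution_radon[OF \<mu>])
      show ?thesis using that by (rule r.cdf_nondecreasing)
    qed
  qed
  then show ?thesis
    by (simp add: rcdt_def cdt_def split_beta')
qed

lemma measurable_nrcdt:
  assumes \<mu>: "prob_space \<mu>" "sets \<mu> = sets borel"
  shows "nrcdt M \<mu> \<in> borel_measurable (M \<Otimes>\<^sub>M unif_S1)"
proof -
  interpret U: prob_space unif_S1 by (rule prob_space_unif_S1)
  note r = measurable_rcdt_pair[OF \<mu>]
  have r'[measurable]: "(\<lambda>(\<theta>, t). rcdt M \<mu> \<theta> t) \<in> borel_measurable (unif_S1 \<Otimes>\<^sub>M M)"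
    using measurable_compose[OF measurable_pair_swap' r] by (simp add: split_beta')
  have m[measurable]: "(\<lambda>\<theta>. mean M (rcdt M \<mu> \<theta>)) \<in> borel_measurable unif_S1"
    unfolding mean_def by measurable
  have s[measurable]: "(\<lambda>\<theta>. std M (rcdt M \<mu> \<theta>)) \<in> borel_measurable unif_S1"
    unfolding std_def by measurable
  have "(\<lambda>p. (rcdt M \<mu> (snd p) (fst p) - mean M (rcdt M \<mu> (snd p))) / std M (rcdt M \<mu> (snd p)))
     \<in> borel_measurable (M \<Otimes>\<^sub>M unif_S1)"
    using r by (auto simp: split_beta' intro!: borel_measurable_divide borel_measurable_diff
       measurable_compose[OF measurable_snd m] measurable_compose[OF measurable_snd s])
  then show ?thesis by (simp add: nrcdt_def split_beta')
qed

lemma scaleR_norm_sgn: "norm u *\<^sub>R sgn u = (u :: 'a :: real_normed_vector)"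
  by (cases "u = 0") (simp_all add: sgn_div_norm)

lemma radon_distr_affine:
  assumes \<mu>: "sets \<mu> = sets borel" and T: "T \<in> \<mu> \<rightarrow>\<^sub>M borel"
    and eq: "\<And>x. T x \<bullet> \<theta> = a * (x \<bullet> h) + b"
  shows "radon (distr \<mu> borel T) \<theta> = distr (radon \<mu> h) borel (\<lambda>x. a * x + b)"
proof -
  have "radon (distr \<mu> borel T) \<theta> = distr \<mu> borel ((\<lambda>x. x \<bullet> \<theta>) \<circ> T)"
    unfolding radon_def by (rule distr_distr[OF _ T]) simp
  also have "(\<lambda>x. x \<bullet> \<theta>) \<circ> T = (\<lambda>x. a * x + b) \<circ> (\<lambda>x. x \<bullet> h)"
    by (simp add: fun_eq_iff eq)
  also have "distr \<mu> borel ((\<lambda>x. a * x + b) \<circ> (\<lambda>x. x \<bullet> h)) = distr (radon \<mu> h) borel (\<lambda>x. a * x + b)"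
    unfolding radon_def by (rule distr_distr[symmetric, OF _ measurable_inner_const[OF \<mu>]]) simp
  finally show ?thesis .
qed

lemma radon_affine:
  fixes A :: "real^2^2"
  assumes \<mu>: "sets \<mu> = sets borel" and B: "transpose A *v \<theta> \<noteq> 0"
  shows "radon (distr \<mu> borel (\<lambda>x. A *v x + y)) \<theta> =
    distr (radon \<mu> (sgn (transpose A *v \<theta>))) borel (\<lambda>x. norm (transpose A *v \<theta>) * x + y \<bullet> \<theta>)"
proof (rule radon_distr_affine[OF \<mu>])
  show "(\<lambda>x. A *v x + y) \<in> \<mu> \<rightarrow>\<^sub>M borel"
    unfolding measurable_cong_sets[OF \<mu> refl]
    by (intro borel_measurable_add borel_measurable_matrix_vector_mult borel_measurable_const)
  fix x
  have "(A *v x) \<bullet> \<theta> = \<theta> \<bullet> (A *v x)" by (rule inner_commute)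
  also have "\<dots> = (\<theta> v* A) \<bullet> x" by (rule dot_lmul_matrix[symmetric])
  also have "\<dots> = x \<bullet> (\<theta> v* A)" by (rule inner_commute)
  also have "\<dots> = x \<bullet> (transpose A *v \<theta>)" by (simp only: transpose_matrix_vector)
  also have "\<dots> = x \<bullet> (norm (transpose A *v \<theta>) *\<^sub>R sgn (transpose A *v \<theta>))"
    by (simp only: scaleR_norm_sgn)
  also have "\<dots> = norm (transpose A *v \<theta>) * (x \<bullet> sgn (transpose A *v \<theta>))"
    by (rule inner_scaleR_right)
  finally show "(A *v x + y) \<bullet> \<theta> = norm (transpose A *v \<theta>) * (x \<bullet> sgn (transpose A *v \<theta>)) + y \<bullet> \<theta>"
    by (simp only: inner_add_left)
qed

text \<open>The normalized R-CDT of an affine image is that of the original measure with the direction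
  transformed by the adjoint and projected back to the circle.\<close>

lemma nrcdt_affine:
  fixes A :: "real^2^2"
  assumes \<mu>: "\<mu> \<in> P2" and B: "transpose A *v \<theta> \<noteq> 0" and t: "0 < cdf M t" "cdf M t < 1"
  shows "nrcdt M (distr \<mu> borel (\<lambda>x. A *v x + y)) (t, \<theta>) = nrcdt M \<mu> (t, sgn (transpose A *v \<theta>))"
proof -
  let ?a = "norm (transpose A *v \<theta>)" and ?h = "sgn (transpose A *v \<theta>)"
  let ?\<mu> = "distr \<mu> borel (\<lambda>x. A *v x + y)"
  have a: "0 < ?a" using B by simp
  have r: "real_distribution (radon \<mu> ?h)"
    by (rule real_distribution_radon[OF P2_prob_space[OF \<mu>] P2_sets[OF \<mu>]])
  have eq: "rcdt M ?\<mu> \<theta> t = ?a * rcdt M \<mu> ?h t + y \<bullet> \<theta>" if "0 < cdf M t" "cdf M t < 1" for t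
    unfolding rcdt_def radon_affine[OF P2_sets[OF \<mu>] B]
    by (rule cdt_affine[OF r that a])
  have "real_distribution (radon ?\<mu> \<theta>)"
    unfolding radon_affine[OF P2_sets[OF \<mu>] B]
  proof -
    interpret r: real_distribution "radon \<mu> ?h" by fact
    show "real_distribution (distr (radon \<mu> ?h) borel (\<lambda>x. ?a * x + y \<bullet> \<theta>))"
      by (rule r.real_distribution_distr, subst measurable_cong_sets[OF r.M_is_borel refl]) measurable
  qed
  from measurable_cdt[OF this] have m: "rcdt M ?\<mu> \<theta> \<in> borel_measurable M"
    unfolding rcdt_def measurable_cong_sets[OF M_is_borel refl] .
  have ae: "AE t in M. rcdt M ?\<mu> \<theta> t = ?a * rcdt M \<mu> ?h t + y \<bullet> \<theta>"
    using AE_cdf_01 by (rule AE_mp) (intro AE_I2 impI eq; simp only:)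
  show ?thesis
    unfolding nrcdt_eq_standardize
    by (rule standardize_affine[OF prob_space_axioms L2_rcdt[OF \<mu>] m a ae eq[OF t]])
qed

end

section \<open>The mean-normalized R-CDT and its separation property\<close>

context atomless_distribution
begin

lemma min_std_le:
  assumes "\<theta> \<in> S1"
  shows "min_std M \<mu> \<le> std M (rcdt M \<mu> \<theta>)"
  unfolding min_std_def
  by (rule cINF_lower[OF _ assms]) (auto intro!: bdd_belowI[of _ 0] simp: std_def)

lemma nn_integral_nrcdt_square:
  assumes \<mu>: "\<mu> \<in> P2" and "0 < std M (rcdt M \<mu> \<theta>)"
  shows "(\<integral>\<^sup>+t. ennreal ((nrcdt M \<mu> (t, \<theta>))\<^sup>2) \<partial>M) = 1"
  unfolding nrcdt_eq_standardize
  using nn_integral_L2[OF L2_standardize[OF prob_space_axioms L2_rcdt[OF \<mu>, of \<theta>]]]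
    L2_norm_standardize[OF prob_space_axioms assms(2)] by simp

lemma L2_norm_nrcdt:
  assumes \<mu>: "\<mu> \<in> P2" and pos: "\<And>\<theta>. \<theta> \<in> S1 \<Longrightarrow> 0 < std M (rcdt M \<mu> \<theta>)"
  shows "L2_norm (M \<Otimes>\<^sub>M unif_S1) (nrcdt M \<mu>) = 1"
proof -
  interpret U: prob_space unif_S1 by (rule prob_space_unif_S1)
  interpret pair_sigma_finite M unif_S1 by unfold_locales
  note m[measurable] = measurable_nrcdt[OF P2_prob_space[OF \<mu>] P2_sets[OF \<mu>]]
  have "(\<integral>\<^sup>+p. ennreal ((nrcdt M \<mu> p)\<^sup>2) \<partial>(M \<Otimes>\<^sub>M unif_S1)) = (\<integral>\<^sup>+\<theta>. \<integral>\<^sup>+t. ennreal ((nrcdt M \<mu> (t, \<theta>))\<^sup>2) \<partial>M \<partial>unif_S1)"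
    by (rule nn_integral_snd[symmetric]) measurable
  also have "\<dots> = (\<integral>\<^sup>+\<theta>. 1 \<partial>unif_S1)"
    by (rule nn_integral_cong) (simp only: nn_integral_nrcdt_square[OF \<mu> pos] space_unif_S1)
  finally have "(\<integral>\<^sup>+p. ennreal ((nrcdt M \<mu> p)\<^sup>2) \<partial>(M \<Otimes>\<^sub>M unif_S1)) = ennreal 1"
    by (simp add: U.emeasure_space_1 del: space_unif_S1)
  then have "(\<integral>p. (nrcdt M \<mu> p)\<^sup>2 \<partial>(M \<Otimes>\<^sub>M unif_S1)) = 1"
    by (subst integral_eq_nn_integral) simp_all
  then show ?thesis by (simp add: L2_norm_def)
qed

lemma mnrcdt_L2:
  assumes \<mu>: "\<mu> \<in> P2" and pos: "\<And>\<theta>. \<theta> \<in> S1 \<Longrightarrow> 0 < std M (rcdt M \<mu> \<theta>)"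
  shows "mnrcdt M \<mu> \<in> L2 M" and "AE t in M. integrable unif_S1 (\<lambda>\<theta>. nrcdt M \<mu> (t, \<theta>))"
proof -
  have "(\<integral>\<^sup>+t. ennreal ((nrcdt M \<mu> (t, \<theta>))\<^sup>2) \<partial>M) \<le> ennreal (1\<^sup>2)" if "\<theta> \<in> space unif_S1" for \<theta>
    using nn_integral_nrcdt_square[OF \<mu> pos, of \<theta>] that by simp
  note avg = L2_average[OF prob_space_unif_S1 sigma_finite_measure_axioms
      measurable_nrcdt[OF P2_prob_space[OF \<mu>] P2_sets[OF \<mu>]] zero_le_one this]
  show "mnrcdt M \<mu> \<in> L2 M" using avg(1) by (simp only: mnrcdt_def[abs_def])
  show "AE t in M. integrable unif_S1 (\<lambda>\<theta>. nrcdt M \<mu> (t, \<theta>))" by (rule avg(3))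
qed

text \<open>Stability of the transform under Wasserstein perturbations. Positivity of the standard deviations of
  \<open>\<mu>\<close> is part of the conclusion: they differ from those of \<open>\<nu>\<close>, which are at least \<open>m\<close>, by at most
  \<open>\<epsilon> < m\<close>.\<close>

lemma mnrcdt_perturbation:
  assumes \<mu>: "\<mu> \<in> P2" and \<nu>: "\<nu> \<in> P2" and W: "W2 \<mu> \<nu> \<le> \<epsilon>" and m: "0 < m" "m \<le> min_std M \<nu>" "\<epsilon> < m"
  shows "\<And>\<theta>. \<theta> \<in> S1 \<Longrightarrow> 0 < std M (rcdt M \<mu> \<theta>)" "\<And>\<theta>. \<theta> \<in> S1 \<Longrightarrow> 0 < std M (rcdt M \<nu> \<theta>)"
    and "L2_norm M (\<lambda>t. mnrcdt M \<mu> t - mnrcdt M \<nu> t) \<le> 2 * \<epsilon> / m"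
proof -
  have d: "L2_norm M (\<lambda>t. rcdt M \<mu> \<theta> t - rcdt M \<nu> \<theta> t) \<le> \<epsilon>" if "\<theta> \<in> S1" for \<theta>
    using rcdt_dist_le_W2[OF \<mu> \<nu>, of \<theta>] W that by simp
  have s: "m \<le> std M (rcdt M \<nu> \<theta>)" if "\<theta> \<in> S1" for \<theta>
    using min_std_le[OF that, of \<nu>] m by simp
  show p\<nu>: "0 < std M (rcdt M \<nu> \<theta>)" if "\<theta> \<in> S1" for \<theta>
    using s[OF that] m by simp
  show p\<mu>: "0 < std M (rcdt M \<mu> \<theta>)" if "\<theta> \<in> S1" for \<theta>
    using std_diff_le[OF prob_space_axioms L2_rcdt[OF \<mu>, of \<theta>] L2_rcdt[OF \<nu>, of \<theta>]] d[OF that] s[OF that] m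
    by linarith
  have "0 \<le> \<epsilon>" using d[of "axis 1 1"] L2_norm_nonneg[of M] by (force simp: intro: order_trans)
  define g where "g p = nrcdt M \<mu> p - nrcdt M \<nu> p" for p
  have g: "g \<in> borel_measurable (M \<Otimes>\<^sub>M unif_S1)"
    unfolding g_def[abs_def] by (intro borel_measurable_diff measurable_nrcdt P2_prob_space P2_sets \<mu> \<nu>)
  have "(\<integral>\<^sup>+t. ennreal ((g (t, \<theta>))\<^sup>2) \<partial>M) \<le> ennreal ((2 * \<epsilon> / m)\<^sup>2)" if "\<theta> \<in> space unif_S1" for \<theta>
  proof -
    have \<theta>: "\<theta> \<in> S1" using that by simp
    let ?f = "rcdt M \<mu> \<theta>" and ?h = "rcdt M \<nu> \<theta>"
    have f: "?f \<in> L2 M" "?h \<in> L2 M" by (rule L2_rcdt, fact)+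
    have "L2_norm M (\<lambda>t. standardize M ?f t - standardize M ?h t) \<le> 2 * L2_norm M (\<lambda>t. ?f t - ?h t) / std M ?h"
      by (rule L2_norm_standardize_diff_le[OF prob_space_axioms f p\<mu>[OF \<theta>] p\<nu>[OF \<theta>]])
    also have "\<dots> \<le> 2 * \<epsilon> / m"
      using d[OF \<theta>] s[OF \<theta>] m(1) \<open>0 \<le> \<epsilon>\<close> by (intro frac_le) auto
    finally have "(L2_norm M (\<lambda>t. standardize M ?f t - standardize M ?h t))\<^sup>2 \<le> (2 * \<epsilon> / m)\<^sup>2"
      by (rule power_mono) (rule L2_norm_nonneg)
    then show ?thesis
      unfolding g_def nrcdt_eq_standardize
      by (subst nn_integral_L2[OF L2_diff[OF L2_standardize[OF prob_space_axioms f(1)] L2_standardize[OF prob_space_axioms f(2)]]])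
        (rule ennreal_leI)
  qed
  note avg = L2_average[OF prob_space_unif_S1 sigma_finite_measure_axioms g _ this]
  have K: "0 \<le> 2 * \<epsilon> / m" using \<open>0 \<le> \<epsilon>\<close> m(1) by simp
  have "L2_norm M (\<lambda>t. mnrcdt M \<mu> t - mnrcdt M \<nu> t) = L2_norm M (\<lambda>t. \<integral>\<theta>. g (t, \<theta>) \<partial>unif_S1)"
  proof (rule L2_norm_cong_AE)
    show "(\<lambda>t. mnrcdt M \<mu> t - mnrcdt M \<nu> t) \<in> borel_measurable M"
      by (rule L2_measurable[OF L2_diff[OF mnrcdt_L2(1)[OF \<mu> p\<mu>] mnrcdt_L2(1)[OF \<nu> p\<nu>]]])
    show "(\<lambda>t. \<integral>\<theta>. g (t, \<theta>) \<partial>unif_S1) \<in> borel_measurable M"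
      by (rule L2_measurable[OF avg(1)[OF K]])
    have "AE t in M. integrable unif_S1 (\<lambda>\<theta>. nrcdt M \<mu> (t, \<theta>))" by (rule mnrcdt_L2(2)[OF \<mu> p\<mu>])
    moreover have "AE t in M. integrable unif_S1 (\<lambda>\<theta>. nrcdt M \<nu> (t, \<theta>))" by (rule mnrcdt_L2(2)[OF \<nu> p\<nu>])
    ultimately show "AE t in M. mnrcdt M \<mu> t - mnrcdt M \<nu> t = (\<integral>\<theta>. g (t, \<theta>) \<partial>unif_S1)"
      by eventually_elim (simp add: g_def mnrcdt_def)
  qed
  then show "L2_norm M (\<lambda>t. mnrcdt M \<mu> t - mnrcdt M \<nu> t) \<le> 2 * \<epsilon> / m"
    using avg(2)[OF K] by simp
qed

text \<open>The transform of \<open>\<mu>'\<close> is the circle average of \<open>H\<close>, and that of \<open>\<mu>\<close> is, by substitution, the average of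
  \<open>w * H\<close>. As each \<open>H (\<cdot>, \<theta>)\<close> has norm \<open>1\<close>, the distance is at most the supremum of \<open>\<bar>1 - w\<bar>\<close>.\<close>

lemma mnrcdt_affine:
  fixes A :: "real^2^2" and y :: "real^2"
  assumes \<mu>: "\<mu> \<in> P2" and pos: "\<And>\<theta>. \<theta> \<in> S1 \<Longrightarrow> 0 < std M (rcdt M \<mu> \<theta>)" and A: "invertible A"
  defines "\<mu>' \<equiv> distr \<mu> borel (\<lambda>x. A *v x + y)"
  shows "mnrcdt M \<mu>' \<in> L2 M"
    and "L2_norm M (\<lambda>t. mnrcdt M \<mu>' t - mnrcdt M \<mu> t) \<le> (sigma_max A - sigma_min A) / sigma_min A"
proof -
  interpret \<mu>: prob_space \<mu> by (rule P2_prob_space[OF \<mu>])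
  interpret U: prob_space unif_S1 by (rule prob_space_unif_S1)
  let ?B = "transpose A" and ?N = "nrcdt M \<mu>"
  define h where "h \<theta> = sgn (?B *v \<theta>)" for \<theta>
  define w where "w \<theta> = \<bar>det ?B\<bar> / (norm (?B *v \<theta>))\<^sup>2" for \<theta>
  define \<kappa> where "\<kappa> = (sigma_max A - sigma_min A) / sigma_min A"
  have det: "det ?B \<noteq> 0" using A by (simp add: det_transpose invertible_det_nz)
  have B0: "?B *v \<theta> \<noteq> 0" if "\<theta> \<noteq> 0" for \<theta>
    using matrix_vector_mult_eq_0D[OF det, of \<theta>] that by blast
  have h: "h \<in> unif_S1 \<rightarrow>\<^sub>M unif_S1"
    unfolding h_def[abs_def] by (rule measurable_sgn_linear[OF det])
  have hS: "h \<theta> \<in> S1" if "\<theta> \<in> S1" for \<theta>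
    using measurable_space[OF h, of \<theta>] that by simp
  note [measurable] = borel_measurable_unif_S1I[OF borel_measurable_matrix_vector_mult[of ?B]]
  have w: "w \<in> borel_measurable unif_S1"
    unfolding w_def[abs_def] by measurable
  have w1: "\<bar>1 - w \<theta>\<bar> \<le> \<kappa>" if "\<theta> \<in> S1" for \<theta>
    using circle_jacobian_bound[OF A, of \<theta>] that by (simp add: w_def \<kappa>_def det_transpose)
  have \<kappa>: "0 \<le> \<kappa>" using singular_values_2x2[of A] by (simp add: \<kappa>_def)
  define H where "H p = ?N (fst p, h (snd p))" for p
  define g where "g p = (1 - w (snd p)) * H p" for p
  have mN: "?N \<in> borel_measurable (M \<Otimes>\<^sub>M unif_S1)"
    by (rule measurable_nrcdt[OF P2_prob_space[OF \<mu>] P2_sets[OF \<mu>]])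
  have mH: "H \<in> borel_measurable (M \<Otimes>\<^sub>M unif_S1)"
    unfolding H_def[abs_def]
    by (rule measurable_compose[OF measurable_Pair mN]) (rule measurable_fst, rule measurable_compose[OF measurable_snd h])
  have mg: "g \<in> borel_measurable (M \<Otimes>\<^sub>M unif_S1)"
    unfolding g_def[abs_def]
    by (intro borel_measurable_times borel_measurable_diff borel_measurable_const mH measurable_compose[OF measurable_snd w])
  have H1: "(\<integral>\<^sup>+t. ennreal ((H (t, \<theta>))\<^sup>2) \<partial>M) = 1" if "\<theta> \<in> S1" for \<theta>
    unfolding H_def fst_conv snd_conv by (rule nn_integral_nrcdt_square[OF \<mu> pos[OF hS[OF that]]])
  have "(\<integral>\<^sup>+t. ennreal ((H (t, \<theta>))\<^sup>2) \<partial>M) \<le> ennreal (1\<^sup>2)" if "\<theta> \<in> space unif_S1" for \<theta>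
    using H1[of \<theta>] that by simp
  note avgH = L2_average[OF prob_space_unif_S1 sigma_finite_measure_axioms mH zero_le_one this]
  have "(\<integral>\<^sup>+t. ennreal ((g (t, \<theta>))\<^sup>2) \<partial>M) \<le> ennreal (\<kappa>\<^sup>2)" if "\<theta> \<in> space unif_S1" for \<theta>
  proof -
    have \<theta>: "\<theta> \<in> S1" using that by simp
    have mt: "(\<lambda>t. H (t, \<theta>)) \<in> borel_measurable M"
      by (rule measurable_compose[OF measurable_Pair2'[OF that] mH])
    have "(\<integral>\<^sup>+t. ennreal ((g (t, \<theta>))\<^sup>2) \<partial>M) = (\<integral>\<^sup>+t. ennreal ((1 - w \<theta>)\<^sup>2) * ennreal ((H (t, \<theta>))\<^sup>2) \<partial>M)"
      by (simp add: g_def power_mult_distrib ennreal_mult)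
    also have "\<dots> = ennreal ((1 - w \<theta>)\<^sup>2)"
      using mt by (subst nn_integral_cmult) (auto simp: H1[OF \<theta>])
    also have "\<dots> \<le> ennreal (\<kappa>\<^sup>2)"
      using power_mono[OF w1[OF \<theta>], of 2] by (intro ennreal_leI) simp
    finally show ?thesis .
  qed
  note avgg = L2_average[OF prob_space_unif_S1 sigma_finite_measure_axioms mg \<kappa> this]
  have \<mu>': "prob_space \<mu>'" "sets \<mu>' = sets borel"
  proof -
    have "(\<lambda>x. A *v x + y) \<in> \<mu> \<rightarrow>\<^sub>M borel"
      unfolding measurable_cong_sets[OF P2_sets[OF \<mu>] refl]
      by (intro borel_measurable_add borel_measurable_matrix_vector_mult borel_measurable_const)
    then show "prob_space \<mu>'" unfolding \<mu>'_def by (rule \<mu>.prob_space_distr)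
  qed (simp add: \<mu>'_def)
  have eq1: "mnrcdt M \<mu>' t = (\<integral>\<theta>. H (t, \<theta>) \<partial>unif_S1)" if t: "0 < cdf M t" "cdf M t < 1" for t
    unfolding mnrcdt_def
  proof (rule Bochner_Integration.integral_cong[OF refl])
    fix \<theta> assume "\<theta> \<in> space unif_S1"
    then have "\<theta> \<noteq> 0" by auto
    then show "nrcdt M \<mu>' (t, \<theta>) = H (t, \<theta>)"
      unfolding \<mu>'_def H_def h_def fst_conv snd_conv by (intro nrcdt_affine[OF \<mu> B0 t])
  qed
  have eq2: "mnrcdt M \<mu> t = (\<integral>\<theta>. w \<theta> * H (t, \<theta>) \<partial>unif_S1)" for t
  proof -
    have "(\<lambda>\<theta>. ?N (t, \<theta>)) \<in> borel_measurable unif_S1"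
      by (rule measurable_compose[OF measurable_Pair1' mN]) (simp add: borel_UNIV)
    from integral_unif_S1_linear[OF det this] show ?thesis
      by (simp only: mnrcdt_def w_def h_def H_def fst_conv snd_conv)
  qed
  have mL: "mnrcdt M \<mu>' \<in> borel_measurable M"
    unfolding mnrcdt_def[abs_def]
    by (rule U.borel_measurable_lebesgue_integral) (use measurable_nrcdt[OF \<mu>'] in simp)
  have ae1: "AE t in M. mnrcdt M \<mu>' t = (\<integral>\<theta>. H (t, \<theta>) \<partial>unif_S1)"
    using AE_cdf_01 by (rule AE_mp) (intro AE_I2 impI eq1; simp only:)
  have "(\<integral>\<^sup>+t. ennreal ((mnrcdt M \<mu>' t)\<^sup>2) \<partial>M) = (\<integral>\<^sup>+t. ennreal ((\<integral>\<theta>. H (t, \<theta>) \<partial>unif_S1)\<^sup>2) \<partial>M)"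
    by (rule nn_integral_cong_AE) (use ae1 in eventually_elim, simp only:)
  also have "\<dots> = ennreal ((L2_norm M (\<lambda>t. \<integral>\<theta>. H (t, \<theta>) \<partial>unif_S1))\<^sup>2)"
    by (rule nn_integral_L2[OF avgH(1)])
  finally show L2': "mnrcdt M \<mu>' \<in> L2 M"
    by (intro L2I_nn_integral(1)[OF mL L2_norm_nonneg[of M "\<lambda>t. \<integral>\<theta>. H (t, \<theta>) \<partial>unif_S1"]]) simp
  have "L2_norm M (\<lambda>t. mnrcdt M \<mu>' t - mnrcdt M \<mu> t) = L2_norm M (\<lambda>t. \<integral>\<theta>. g (t, \<theta>) \<partial>unif_S1)"
  proof (rule L2_norm_cong_AE)
    show "(\<lambda>t. mnrcdt M \<mu>' t - mnrcdt M \<mu> t) \<in> borel_measurable M"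
      by (rule L2_measurable[OF L2_diff[OF L2' mnrcdt_L2(1)[OF \<mu> pos]]])
    show "(\<lambda>t. \<integral>\<theta>. g (t, \<theta>) \<partial>unif_S1) \<in> borel_measurable M"
      by (rule L2_measurable[OF avgg(1)])
    have "AE t in M. integrable unif_S1 (\<lambda>\<theta>. H (t, \<theta>))" by (rule avgH(3))
    moreover have "AE t in M. integrable unif_S1 (\<lambda>\<theta>. g (t, \<theta>))" by (rule avgg(3))
    ultimately show "AE t in M. mnrcdt M \<mu>' t - mnrcdt M \<mu> t = (\<integral>\<theta>. g (t, \<theta>) \<partial>unif_S1)"
      using ae1
    proof eventually_elim
      case (elim t)
      have "(\<lambda>\<theta>. w \<theta> * H (t, \<theta>)) = (\<lambda>\<theta>. H (t, \<theta>) - g (t, \<theta>))"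
        by (auto simp: g_def algebra_simps)
      then have "mnrcdt M \<mu> t = (\<integral>\<theta>. H (t, \<theta>) \<partial>unif_S1) - (\<integral>\<theta>. g (t, \<theta>) \<partial>unif_S1)"
        using elim(1,2) by (simp add: eq2)
      then show ?case using elim(3) by simp
    qed
  qed
  then show "L2_norm M (\<lambda>t. mnrcdt M \<mu>' t - mnrcdt M \<mu> t) \<le> (sigma_max A - sigma_min A) / sigma_min A"
    using avgg(2) by (simp add: \<kappa>_def)
qed

text \<open>The images of a perturbed affine class lie in a ball around the image of its template; \<open>\<kappa>\<close> bounds
  the relative gap of the singular values.\<close>

lemma mnrcdt_perturbed_affine_class:
  assumes \<nu>: "\<nu> \<in> P2" and m: "0 < m" "m \<le> min_std M \<nu>" "\<epsilon> < m"
    and X: "\<And>A. A \<in> \<X> \<Longrightarrow> invertible A \<and> (sigma_max A - sigma_min A) / sigma_min A \<le> \<kappa>"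
    and \<mu>: "\<mu> \<in> perturbed_affine_class \<X> \<nu> \<epsilon>"
  shows "mnrcdt M \<mu> \<in> L2 M" and "L2_norm M (\<lambda>t. mnrcdt M \<mu> t - mnrcdt M \<nu> t) \<le> \<kappa> + 2 * \<epsilon> / m"
proof -
  obtain A y \<mu>1 where A: "A \<in> \<X>" and \<mu>1: "\<mu>1 \<in> P2" "W2 \<mu>1 \<nu> \<le> \<epsilon>" and eq: "\<mu> = distr \<mu>1 borel (\<lambda>x. A *v x + y)"
    using \<mu> by (auto simp: perturbed_affine_class_def)
  note p = mnrcdt_perturbation[OF \<mu>1(1) \<nu> \<mu>1(2) m]
  note a = mnrcdt_affine[OF \<mu>1(1) p(1) conjunct1[OF X[OF A]], of y, folded eq]
  show "mnrcdt M \<mu> \<in> L2 M" by (rule a(1))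
  have L: "mnrcdt M \<mu>1 \<in> L2 M" "mnrcdt M \<nu> \<in> L2 M"
    using mnrcdt_L2(1)[OF \<mu>1(1) p(1)] mnrcdt_L2(1)[OF \<nu> p(2)] by blast+
  have "L2_norm M (\<lambda>t. (mnrcdt M \<mu> t - mnrcdt M \<mu>1 t) + (mnrcdt M \<mu>1 t - mnrcdt M \<nu> t)) \<le>
      L2_norm M (\<lambda>t. mnrcdt M \<mu> t - mnrcdt M \<mu>1 t) + L2_norm M (\<lambda>t. mnrcdt M \<mu>1 t - mnrcdt M \<nu> t)"
    by (intro L2_norm_add_le L2_diff a(1) L)
  then show "L2_norm M (\<lambda>t. mnrcdt M \<mu> t - mnrcdt M \<nu> t) \<le> \<kappa> + 2 * \<epsilon> / m"
    using a(2) p(3) X[OF A] by simp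
qed

end

theorem theorem4p15:
  fixes \<rho> :: "real measure"
    and \<mu>0 \<nu>0 :: "(real^2) measure"
    and c c' \<epsilon> c_mu c_nu C_mu C_nu D :: real
    and \<X> :: "(real^2^2) set"
    and F G F0 G0 :: "(real^2) measure set"
  assumes rho: "\<rho> \<in> P2" and rho_atomless: "\<And>t. measure \<rho> {t} = 0"
    and mu0: "\<mu>0 \<in> P2_star" and nu0: "\<nu>0 \<in> P2_star"
    and templates_differ: "\<not> (AE t in \<rho>. mnrcdt \<rho> \<mu>0 t = mnrcdt \<rho> \<nu>0 t)"
  defines "c_mu \<equiv> min_std \<rho> \<mu>0" and "C_mu \<equiv> L2_norm (\<rho> \<Otimes>\<^sub>M unif_S1) (nrcdt \<rho> \<mu>0)"
    and "c_nu \<equiv> min_std \<rho> \<nu>0" and "C_nu \<equiv> L2_norm (\<rho> \<Otimes>\<^sub>M unif_S1) (nrcdt \<rho> \<nu>0)"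
    and "D \<equiv> L2_norm \<rho> (\<lambda>t. mnrcdt \<rho> \<mu>0 t - mnrcdt \<rho> \<nu>0 t)"
  assumes c: "0 < c" "c < 1/2" and c': "c < c'" "c' < 1/2"
    and eps: "0 \<le> \<epsilon>" "\<epsilon> < min c_mu c_nu / 2"
    and eps_bound: "\<epsilon> < (c' - c) / 4 * min c_mu c_nu *
                      (D * max C_mu C_nu / (c * D + max C_mu C_nu))"
  defines "\<X> \<equiv> {A. invertible A \<and>
                   (sigma_max A - sigma_min A) / sigma_min A \<le> c / max C_mu C_nu * D}"
    and "F \<equiv> perturbed_affine_class \<X> \<mu>0 \<epsilon>"
    and "G \<equiv> perturbed_affine_class \<X> \<nu>0 \<epsilon>"
  assumes F0: "F0 \<noteq> {}" "F0 \<subseteq> F" and G0: "G0 \<noteq> {}" "G0 \<subseteq> G"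
  shows "mnrcdt \<rho> ` F0 \<subseteq> L2 \<rho> \<and> mnrcdt \<rho> ` G0 \<subseteq> L2 \<rho> \<and>
         (\<exists>\<Phi> b. continuous_linear_functional_L2 \<rho> \<Phi> \<and>
            (\<forall>\<mu>\<in>F0. \<forall>\<nu>\<in>G0. \<Phi> (mnrcdt \<rho> \<mu>) < b \<and> b < \<Phi> (mnrcdt \<rho> \<nu>)))"
proof -
  interpret atomless_distribution \<rho>
  proof (intro atomless_distribution.intro real_distribution.intro)
    show "prob_space \<rho>" by (rule P2_prob_space[OF rho])
    show "real_distribution_axioms \<rho>"
      by unfold_locales (simp_all add: P2_sets[OF rho] P2_space[OF rho])
    show "atomless_distribution_axioms \<rho>" by unfold_locales (rule rho_atomless)
  qed
  have mu: "\<mu>0 \<in> P2" and nu: "\<nu>0 \<in> P2" using mu0 nu0 by (auto simp: P2_star_def)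
  define m where "m = min c_mu c_nu"
  have m: "0 < m" "m \<le> min_std \<rho> \<mu>0" "m \<le> min_std \<rho> \<nu>0" "\<epsilon> < m"
    using eps by (auto simp: m_def c_mu_def c_nu_def)
  have pos: "0 < std \<rho> (rcdt \<rho> \<mu>0 \<theta>)" "0 < std \<rho> (rcdt \<rho> \<nu>0 \<theta>)" if "\<theta> \<in> S1" for \<theta>
    using min_std_le[OF that, of \<mu>0] min_std_le[OF that, of \<nu>0] m by auto
  have C: "C_mu = 1" "C_nu = 1"
    unfolding C_mu_def C_nu_def by (rule L2_norm_nrcdt, fact mu nu, erule pos)+
  have L: "mnrcdt \<rho> \<mu>0 \<in> L2 \<rho>" "mnrcdt \<rho> \<nu>0 \<in> L2 \<rho>"
    using mnrcdt_L2(1)[OF mu pos(1)] mnrcdt_L2(1)[OF nu pos(2)] by blast+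
  have "D \<noteq> 0"
    using L2_norm_zero_imp_AE[OF L2_diff[OF L]] templates_differ by (auto simp: D_def)
  then have D: "0 < D" using L2_norm_nonneg[of \<rho>] by (simp add: D_def order_less_le)
  define r where "r = c * D + 2 * \<epsilon> / m"
  have r0: "0 \<le> r" using c D eps m by (simp add: r_def)
  have r: "2 * r < D"
  proof -
    \<comment> \<open>The factor \<open>1\<close> is \<open>max C_mu C_nu\<close>.\<close>
    have "D * 1 / (c * D + 1) \<le> D"
      using c D by (simp add: divide_le_eq)
    then have "(c' - c) / 4 * m * (D * 1 / (c * D + 1)) \<le> (c' - c) / 4 * m * D"
      using c' m by (intro mult_left_mono) auto
    moreover have "\<epsilon> < (c' - c) / 4 * m * (D * 1 / (c * D + 1))"
      using eps_bound unfolding C m_def by (simp only: max.idem)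
    ultimately have "\<epsilon> < (c' - c) / 4 * m * D" by linarith
    then have "2 * \<epsilon> < ((c' - c) / 2 * D) * m" by (simp add: mult_ac)
    then have "2 * \<epsilon> / m < (c' - c) / 2 * D" using m(1) by (simp only: pos_divide_less_eq)
    then have "2 * r < (c' + c) * D" by (simp add: r_def algebra_simps)
    also have "\<dots> < 1 * D" using c c' D by (intro mult_strict_right_mono) auto
    finally show ?thesis by simp
  qed
  have X: "invertible A \<and> (sigma_max A - sigma_min A) / sigma_min A \<le> c * D" if "A \<in> \<X>" for A
    using that by (simp add: \<X>_def C)
  have F: "mnrcdt \<rho> \<mu> \<in> L2 \<rho>" "L2_norm \<rho> (\<lambda>t. mnrcdt \<rho> \<mu> t - mnrcdt \<rho> \<mu>0 t) \<le> r" if "\<mu> \<in> F0" for \<mu>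
  proof -
    have i: "\<mu> \<in> perturbed_affine_class \<X> \<mu>0 \<epsilon>" using that F0(2) by (auto simp: F_def)
    show "mnrcdt \<rho> \<mu> \<in> L2 \<rho>" by (rule mnrcdt_perturbed_affine_class(1)[OF mu m(1,2,4) X i])
    show "L2_norm \<rho> (\<lambda>t. mnrcdt \<rho> \<mu> t - mnrcdt \<rho> \<mu>0 t) \<le> r"
      unfolding r_def by (rule mnrcdt_perturbed_affine_class(2)[OF mu m(1,2,4) X i])
  qed
  have G: "mnrcdt \<rho> \<nu> \<in> L2 \<rho>" "L2_norm \<rho> (\<lambda>t. mnrcdt \<rho> \<nu> t - mnrcdt \<rho> \<nu>0 t) \<le> r" if "\<nu> \<in> G0" for \<nu>
  proof -
    have i: "\<nu> \<in> perturbed_affine_class \<X> \<nu>0 \<epsilon>" using that G0(2) by (auto simp: G_def)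
    show "mnrcdt \<rho> \<nu> \<in> L2 \<rho>" by (rule mnrcdt_perturbed_affine_class(1)[OF nu m(1,3,4) X i])
    show "L2_norm \<rho> (\<lambda>t. mnrcdt \<rho> \<nu> t - mnrcdt \<rho> \<nu>0 t) \<le> r"
      unfolding r_def by (rule mnrcdt_perturbed_affine_class(2)[OF nu m(1,3,4) X i])
  qed
  obtain \<Phi> b where "continuous_linear_functional_L2 \<rho> \<Phi>"
    and "\<And>f. f \<in> L2 \<rho> \<Longrightarrow> L2_norm \<rho> (\<lambda>t. f t - mnrcdt \<rho> \<mu>0 t) \<le> r \<Longrightarrow> \<Phi> f < b"
    and "\<And>f. f \<in> L2 \<rho> \<Longrightarrow> L2_norm \<rho> (\<lambda>t. f t - mnrcdt \<rho> \<nu>0 t) \<le> r \<Longrightarrow> b < \<Phi> f"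
    using L2_balls_linearly_separable[OF L r0 r[unfolded D_def]] by blast
  with F G have "continuous_linear_functional_L2 \<rho> \<Phi> \<and>
      (\<forall>\<mu>\<in>F0. \<forall>\<nu>\<in>G0. \<Phi> (mnrcdt \<rho> \<mu>) < b \<and> b < \<Phi> (mnrcdt \<rho> \<nu>))" by simp
  with F(1) G(1) show ?thesis by blast
qed

end
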